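(* Let $X_1,X_2,\dots$ be i.i.d. with distribution $F_X$, a $d$-dimensional generalized inner product distribution with signature $(p,q)$, and let $X\sim F_X$. Define $\mathbf{\Delta}:=\mathbb{E}[XX^{\top}]$, and for each $n$ let $\mathbf{Q_X}$ be the $d\times d$ matrix such that $\mathbf{U_P}|\mathbf{\Lambda_P}|^{1/2}\mathbf{Q_X}=\mathbf{X}$. Suppose that $\mathbf{\Delta}\mathbf{I}_{p,q}$ has distinct eigenvalues and is full-rank. Then there exists a deterministic indefinite orthogonal matrix $\tilde{\mathbf{Q}}$ (that is, $\tilde{\mathbf{Q}}\in O(p,q)$) such that $\mathbf{Q_X}\to\tilde{\mathbf{Q}}$ almost surely as $n\to\infty$.
   Context: Let $d=p+q$ and $\mathbf{I}_{p,q}:=\mathrm{diag}(\mathbf{I}_p,-\mathbf{I}_q)$, where $\mathbf{I}_r$ is the $r\times r$ identity matrix. A distribution $F_X$ is a $d$-dimensional generalized inner product distribution with signature $(p,q)$ if it takes values in a set $\Omega\subset\mathbb{R}^d$ such that $x^{\top}\mathbf{I}_{p,q}y\in[0,1]$ for all $x,y\in\Omega$. The indefinite orthogonal group $O(p,q)$ is the set of $d\times d$ real matrices $\mathbf{Q}$ with $\mathbf{Q}\mathbf{I}_{p,q}\mathbf{Q}^{\top}=\mathbf{I}_{p,q}$. For each $n$, $\mathbf{X}$ is the $n\times d$ matrix whose $i$-th row is $X_i^{\top}$, and $\mathbf{P}:=\mathbf{X}\mathbf{I}_{p,q}\mathbf{X}^{\top}$. The eigendecomposition of $\mathbf{P}$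 (restricted to its $d$ nonzero eigenvalues) is written $\mathbf{P}=\mathbf{U_P}\mathbf{\Lambda_P}\mathbf{U_P}^{\top}$, where $\mathbf{\Lambda_P}$ is the $d\times d$ diagonal matrix of the nonzero eigenvalues ordered from largest to smallest and $\mathbf{U_P}$ is the $n\times d$ matrix with orthonormal columns that are the corresponding eigenvectors. $|\mathbf{\Lambda_P}|$ denotes the entrywise absolute value. The matrix $\mathbf{Q_X}$ depends on $n$. Convergence is of $d\times d$ matrices, for which all norms are equivalent.
   Formalization: Since eigenvectors are determined only up to sign, Q_X converges to the deterministic limit after suitable sign choices for the columns of U_P (possibly depending on n and the outcome); U_P and Q_X are shown to exist almost surely for all large n, not for each n. *)

theory Defs
  imports "HOL-Probability.Probability"
begin

text \<open>
  Vectors in \<open>d\<close>-dimensional space have type \<open>'d rvec\<close>, where the finite index type \<open>'d\<close> is linearly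
  ordered so that "the first \<open>p\<close> coordinates" and "ordered from largest to smallest" make sense.
  Matrices with \<open>n\<close> rows and \<open>d\<close> columns, for varying \<open>n\<close>, are sequences \<open>nat \<Rightarrow> 'd rvec\<close> of row
  vectors of which only the rows \<open>i < n\<close> are used; \<open>n \<times> n\<close> matrices are functions
  \<open>nat \<Rightarrow> nat \<Rightarrow> real\<close> used at indices below \<open>n\<close>.  Rows are counted from 0.
\<close>

type_synonym 'd rvec = "(real, 'd) vec"
type_synonym 'd rmat = "((real, 'd) vec, 'd) vec"

definition diag_matrix :: "('d :: finite) rvec \<Rightarrow> 'd rmat" where
  "diag_matrix v = (\<chi> i j. if i = j then v $ i else 0)"

text \<open>The number \<open>card {k. k < i}\<close> is the 0-based position of \<open>i\<close> in the order of \<open>'d\<close>.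
  The last case does not arise when \<open>CARD('d) = p + q\<close>.\<close>

definition sig_matrix :: "nat \<Rightarrow> nat \<Rightarrow> ('d :: {finite, linorder}) rmat" where
  "sig_matrix p q = diag_matrix
     (\<chi> i. if card {k. k < i} < p then 1 else if card {k. k < i} < p + q then - 1 else 0)"

definition indef_orthogonal :: "nat \<Rightarrow> nat \<Rightarrow> ('d :: {finite, linorder}) rmat set" where
  "indef_orthogonal p q = {Q. Q ** sig_matrix p q ** transpose Q = sig_matrix p q}"

definition gip_distribution ::
  "nat \<Rightarrow> nat \<Rightarrow> ('d :: {finite, linorder}) rvec measure \<Rightarrow> bool" where
  "gip_distribution p q F \<longleftrightarrow>
     CARD('d) = p + q \<and> prob_space F \<and> sets F = sets borel \<and>
     (\<exists>\<Omega>. (AE x in F. x \<in> \<Omega>) \<and>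
          (\<forall>x\<in>\<Omega>. \<forall>y\<in>\<Omega>. x \<bullet> (sig_matrix p q *v y) \<in> {0..1}))"

definition outer_prod :: "('d :: finite) rvec \<Rightarrow> 'd rvec \<Rightarrow> 'd rmat" where
  "outer_prod x y = (\<chi> i j. x $ i * y $ j)"

text \<open>This is a matrix-valued Bochner integral; by the usual convention it is the zero matrix
  (which is not of full rank) if the second moments are not all finite.\<close>

definition second_moment :: "('d :: finite) rvec measure \<Rightarrow> 'd rmat" where
  "second_moment F = (\<integral>x. outer_prod x x \<partial>F)"

definition complex_eigenvalues :: "('d :: finite) rmat \<Rightarrow> complex set" where
  "complex_eigenvalues A =
     {z. \<exists>v :: complex ^ 'd. v \<noteq> 0 \<and> map_matrix complex_of_real A *v v = z *s v}"

text \<open>The \<open>d\<close> eigenvalues, counted with algebraic multiplicity, are pairwise distinct iff there are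
  \<open>d\<close> different ones.\<close>

definition distinct_eigenvalues :: "('d :: finite) rmat \<Rightarrow> bool" where
  "distinct_eigenvalues A \<longleftrightarrow> card (complex_eigenvalues A) = CARD('d)"

definition P_matrix ::
  "nat \<Rightarrow> nat \<Rightarrow> (nat \<Rightarrow> ('d :: {finite, linorder}) rvec) \<Rightarrow> nat \<Rightarrow> nat \<Rightarrow> real" where
  "P_matrix p q x i k = x i \<bullet> (sig_matrix p q *v x k)"

text \<open>\<open>P = U \<Lambda> U\<^sup>T\<close> for an \<open>n \<times> n\<close> matrix \<open>P\<close> with exactly \<open>d\<close> nonzero eigenvalues: \<open>L\<close> is the
  diagonal of \<open>\<Lambda>\<close> and the rows of \<open>U\<close> are \<open>U 0, \<dots>, U (n - 1)\<close>.  The sum of outer products of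
  these rows is \<open>U\<^sup>T U\<close>, so the second conjunct says that the columns are orthonormal.\<close>

definition eigendecomposition ::
  "nat \<Rightarrow> (nat \<Rightarrow> nat \<Rightarrow> real) \<Rightarrow>
    (nat \<Rightarrow> ('d :: {finite, linorder}) rvec) \<Rightarrow> 'd rvec \<Rightarrow> bool" where
  "eigendecomposition n P U L \<longleftrightarrow>
     (\<forall>i<n. \<forall>k<n. P i k = U i \<bullet> (diag_matrix L *v U k)) \<and>
     (\<Sum>i<n. outer_prod (U i) (U i)) = mat 1 \<and>
     (\<forall>j. L $ j \<noteq> 0) \<and>
     (\<forall>j k. j \<le> k \<longrightarrow> L $ k \<le> L $ j)"

definition sqrt_abs_diag :: "('d :: finite) rvec \<Rightarrow> 'd rmat" where
  "sqrt_abs_diag L = diag_matrix (\<chi> j. sqrt \<bar>L $ j\<bar>)"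

text \<open>Row by row, \<open>U |\<Lambda>|\<^sup>1\<^sup>/\<^sup>2 Q = X\<close>.  Orthonormality of the columns of \<open>U\<close> and
  invertibility of \<open>\<Lambda>\<close> make \<open>Q\<close> unique.\<close>

definition is_Q_matrix ::
  "nat \<Rightarrow> (nat \<Rightarrow> ('d :: finite) rvec) \<Rightarrow> (nat \<Rightarrow> 'd rvec) \<Rightarrow> 'd rvec \<Rightarrow> 'd rmat \<Rightarrow> bool" where
  "is_Q_matrix n x U L Q \<longleftrightarrow> (\<forall>i<n. U i v* (sqrt_abs_diag L ** Q) = x i)"

text \<open>An eigendecomposition determines eigenvectors of simple eigenvalues only up to sign.  With
  \<open>s $ j \<in> {- 1, 1}\<close>, this operation changes the signs of the columns of \<open>U\<close>; the matrix
  \<open>Q\<close> can converge only for a suitable choice of these signs.\<close>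

definition scale_columns :: "('d :: finite) rvec \<Rightarrow> (nat \<Rightarrow> 'd rvec) \<Rightarrow> nat \<Rightarrow> 'd rvec" where
  "scale_columns s U i = (\<chi> j. s $ j * U i $ j)"

end

theory Submission
  imports Defs
begin

text \<open>
  If \<open>X = U |\<Lambda>|\<^sup>1\<^sup>/\<^sup>2 Q\<close> and \<open>S = X\<^sup>T X\<close>, then \<open>Q\<^sup>T |\<Lambda>| Q = S\<close> and \<open>Q J Q\<^sup>T = sgn \<Lambda>\<close>, where \<open>J\<close> is
  the signature matrix; hence \<open>S J Q\<^sup>T = Q\<^sup>T \<Lambda>\<close>, and the rows of \<open>Q\<close> are eigenvectors of \<open>S J\<close>
  normalised by the indefinite form.  These two equations are unaffected by dividing \<open>S\<close> and \<open>\<Lambda>\<close>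
  by \<open>n\<close>.  Full rank of the second moment forces \<open>\<Omega>\<close> to span the space and so to be bounded;
  Hoeffding's inequality and Borel--Cantelli then give \<open>S / n \<longlonglongrightarrow> \<Delta>\<close> almost surely.  Solutions for
  \<open>S / n\<close> stay bounded because \<open>\<Delta>\<close> is positive definite, and every limit point is a solution for
  \<open>\<Delta>\<close>; as \<open>\<Delta> J\<close> has simple spectrum, the latter is unique up to the signs of the rows of \<open>Q\<close>.
  By Sylvester's law of inertia it lies in \<open>O(p, q)\<close>.
\<close>

section \<open>Factorizations and eigendecompositions\<close>

definition abs_vec :: "('d :: finite) rvec \<Rightarrow> 'd rvec" where
  "abs_vec l = (\<chi> j. \<bar>l $ j\<bar>)"

definition sgn_vec :: "('d :: finite) rvec \<Rightarrow> 'd rvec" where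
  "sgn_vec l = (\<chi> j. sgn (l $ j))"

text \<open>For \<open>S = X\<^sup>T X\<close> and \<open>P = X J X\<^sup>T\<close>, the solutions \<open>(l, Q)\<close> are exactly the pairs arising
  from an eigendecomposition \<open>P = U diag l U\<^sup>T\<close> with \<open>U |diag l|\<^sup>1\<^sup>/\<^sup>2 Q = X\<close>, so that the
  \<open>n \<times> n\<close> problem is traded for a \<open>d \<times> d\<close> one.\<close>

definition indef_factorization ::
  "('d :: {finite, linorder}) rmat \<Rightarrow> 'd rmat \<Rightarrow> 'd rvec \<Rightarrow> 'd rmat \<Rightarrow> bool" where
  "indef_factorization J S l Q \<longleftrightarrow>
     Q ** J ** transpose Q = diag_matrix (sgn_vec l) \<and>
     transpose Q ** diag_matrix (abs_vec l) ** Q = S \<and>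
     (\<forall>j. l $ j \<noteq> 0) \<and>
     (\<forall>j k. j \<le> k \<longrightarrow> l $ k \<le> l $ j)"

section \<open>Algebra of diagonal matrices and of sums of outer products\<close>

lemma transpose_diag_matrix [simp]: "transpose (diag_matrix v) = diag_matrix v"
  by (auto simp: transpose_def diag_matrix_def vec_eq_iff)

lemma diag_matrix_nth: "diag_matrix a $ i $ j = (if i = j then a $ i else 0)"
  by (simp add: diag_matrix_def)

lemma diag_matrix_left_nth: "(diag_matrix a ** A) $ i $ j = a $ i * A $ i $ j"
  by (simp add: diag_matrix_def matrix_matrix_mult_def mult_delta_left)

lemma diag_matrix_right_nth: "(A ** diag_matrix a) $ i $ j = A $ i $ j * a $ j"
  by (simp add: diag_matrix_def matrix_matrix_mult_def mult_delta_right)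

lemma diag_matrix_mult: "diag_matrix a ** diag_matrix b = diag_matrix (a * b)"
  by (simp add: vec_eq_iff diag_matrix_left_nth diag_matrix_nth)

lemma diag_matrix_vector: "diag_matrix a *v x = a * x"
  by (simp add: diag_matrix_def matrix_vector_mult_def vec_eq_iff mult_delta_left)

lemma diag_matrix_1: "(\<And>j. v $ j = 1) \<Longrightarrow> diag_matrix v = mat 1"
  by (simp add: diag_matrix_def mat_def vec_eq_iff)

lemma sgn_sgn_diag: "(\<And>j. l $ j \<noteq> 0) \<Longrightarrow> diag_matrix (sgn_vec l) ** diag_matrix (sgn_vec l) = mat 1"
  unfolding diag_matrix_mult by (rule diag_matrix_1) (simp add: sgn_vec_def flip: sgn_mult)

lemma transpose_nth: "transpose A $ i $ j = A $ j $ i"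
  by (simp add: transpose_def)

lemma inner_matrix_vector: "x \<bullet> (A *v y) = (transpose A *v x) \<bullet> y" for A :: "real ^ 'n ^ 'm"
  by (simp add: dot_lmul_matrix)

lemma outer_prod_vector: "outer_prod x y *v z = (y \<bullet> z) *\<^sub>R x"
  by (simp add: outer_prod_def matrix_vector_mult_def vec_eq_iff inner_vec_def sum_distrib_left mult_ac)

lemma sum_matrix_vector: "(\<Sum>i\<in>I. A i) *v z = (\<Sum>i\<in>I. A i *v z)" for A :: "'b \<Rightarrow> ('d :: finite) rmat"
  by (induction I rule: infinite_finite_induct) (simp_all add: matrix_vector_mult_add_rdistrib)

lemma sum_outer_vector: "(\<Sum>i\<in>I. outer_prod (x i) (y i)) *v z = (\<Sum>i\<in>I. (y i \<bullet> z) *\<^sub>R x i)"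
  by (simp add: sum_matrix_vector outer_prod_vector)

lemma matrix_vector_sum: "A *v (\<Sum>i\<in>I. f i) = (\<Sum>i\<in>I. A *v f i)" for A :: "real ^ 'n ^ 'm"
  using linear_sum[OF matrix_vector_mul_linear] .

text \<open>The sum of outer products is \<open>X^T X\<close> for the matrix \<open>X\<close> with
  rows \<open>x i\<close>; applying \<open>A\<close> to every row replaces \<open>X\<close> by
  \<open>X A^T\<close>.\<close>

lemma sum_outer_congruence:
  "A ** (\<Sum>i\<in>I. outer_prod (x i) (x i)) ** transpose A = (\<Sum>i\<in>I. outer_prod (A *v x i) (A *v x i))"
proof -
  have "A *v (S *v (transpose A *v z)) = (\<Sum>i\<in>I. outer_prod (A *v x i) (A *v x i)) *v z"
    if "S = (\<Sum>i\<in>I. outer_prod (x i) (x i))" for S z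
    unfolding that sum_outer_vector matrix_vector_sum matrix_vector_mult_scaleR
    by (simp add: inner_matrix_vector[of _ "transpose A"] del: transpose_matrix_vector)
  from this[OF refl] show ?thesis by (simp add: matrix_eq flip: matrix_vector_mul_assoc)
qed

text \<open>Orthonormal columns make the rows \<open>U i\<close> a Parseval frame: each
  \<open>y\<close> is the sum of the vectors \<open>(U i \<bullet> y) *\<^sub>R U i\<close>. The
  values of a form on pairs of rows therefore determine its matrix.\<close>

lemma matrix_eq_of_bilinear_eq:
  assumes "(\<Sum>i<(n::nat). outer_prod (U i) (U i)) = mat 1"
    and eq: "\<And>i k. i < n \<Longrightarrow> k < n \<Longrightarrow> U i \<bullet> (A *v U k) = U i \<bullet> (B *v U k)"
  shows "A = B"
proof -
  have ex: "y = (\<Sum>i<n. (U i \<bullet> y) *\<^sub>R U i)" for y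
    using arg_cong[OF assms(1), of "\<lambda>A. A *v y"] by (simp add: sum_outer_vector)
  have "A *v U k = B *v U k" if "k < n" for k
    using ex[of "A *v U k"] ex[of "B *v U k"] eq that by (metis (no_types, lifting) lessThan_iff sum.cong)
  then have "A *v y = B *v y" for y
    by (subst (1 2) ex[of y]) (simp add: matrix_vector_sum matrix_vector_mult_scaleR)
  then show ?thesis by (simp add: matrix_eq)
qed

section \<open>Passage between \<open>n \<times> n\<close> eigendecompositions and
  \<open>d \<times> d\<close> factorizations\<close>

text \<open>As \<open>sgn l\<close> squares to the identity, the normalisation
  \<open>Q J Q^T = sgn l\<close> displays a right inverse of \<open>Q\<close>. For square matrices
  it is also a left inverse, and cancelling \<open>J\<close> turns the normalisation around.\<close>

lemma indef_factorization_inverse: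
  assumes "indef_factorization J S l Q" and J: "J ** J = mat 1"
  shows "J ** transpose Q ** diag_matrix (sgn_vec l) ** Q = mat 1"
    and "transpose Q ** diag_matrix (sgn_vec l) ** Q = J"
    and "Q ** (J ** transpose Q ** diag_matrix (sgn_vec l)) = mat 1"
proof -
  show 1: "Q ** (J ** transpose Q ** diag_matrix (sgn_vec l)) = mat 1"
    using assms by (simp add: indef_factorization_def matrix_mul_assoc sgn_sgn_diag)
  then show 2: "J ** transpose Q ** diag_matrix (sgn_vec l) ** Q = mat 1"
    by (simp add: matrix_left_right_inverse)
  have "J ** (J ** transpose Q ** diag_matrix (sgn_vec l) ** Q) = J" by (simp only: 2 matrix_mul_rid)
  then show "transpose Q ** diag_matrix (sgn_vec l) ** Q = J"
    by (simp add: matrix_mul_assoc J)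
qed

lemma abs_sgn_diag: 
  "diag_matrix (abs_vec l) ** diag_matrix (sgn_vec l) = diag_matrix l"
  "diag_matrix (sgn_vec l) ** diag_matrix (abs_vec l) = diag_matrix l"
  "diag_matrix (sgn_vec l) ** diag_matrix l = diag_matrix (abs_vec l)"
  by (auto simp: diag_matrix_nth diag_matrix_mult abs_vec_def sgn_vec_def vec_eq_iff sgn_if)

lemma indef_factorization_eigen:
  assumes R: "indef_factorization J S l Q"
  shows "S ** J ** transpose Q = transpose Q ** diag_matrix l"
proof -
  have "S ** J ** transpose Q = transpose Q ** diag_matrix (abs_vec l) ** (Q ** J ** transpose Q)"
    using R unfolding indef_factorization_def by (metis matrix_mul_assoc)
  also have "\<dots> = transpose Q ** (diag_matrix (abs_vec l) ** diag_matrix (sgn_vec l))"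
    using R by (simp add: indef_factorization_def matrix_mul_assoc)
  finally show ?thesis by (simp add: abs_sgn_diag)
qed

text \<open>Simultaneous diagonalisation produces a \<open>Q\<close> that diagonalises
  \<open>J\<close> and \<open>J S J\<close>. The explicit inverse of \<open>Q\<close> converts this
  into the expression of \<open>S\<close> through \<open>Q^T\<close>.\<close>

lemma indef_factorizationI:
  assumes J: "J ** J = mat 1"
    and Q: "Q ** J ** transpose Q = diag_matrix (sgn_vec l)"
    and S: "Q ** (J ** S ** J) ** transpose Q = diag_matrix (abs_vec l)"
    and l: "\<forall>j. l $ j \<noteq> 0" "\<forall>j k. j \<le> k \<longrightarrow> l $ k \<le> l $ j"
  shows "indef_factorization J S l Q"
proof -
  let ?D = "diag_matrix (sgn_vec l)"
  have 1: "Q ** (J ** transpose Q ** ?D) = mat 1"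
    using Q l by (simp add: matrix_mul_assoc sgn_sgn_diag)
  then have 2: "J ** transpose Q ** ?D ** Q = mat 1"
    by (simp add: matrix_left_right_inverse)
  have "J ** (J ** transpose Q ** ?D ** Q) = J" by (simp only: 2 matrix_mul_rid)
  then have 3: "transpose Q ** ?D ** Q = J" by (simp add: matrix_mul_assoc J)
  \<comment> \<open>Each outer \<open>J\<close> of \<open>J (J S J) J\<close> is about to be
    replaced by \<open>Q^T sgn l Q\<close>, which exposes the assumption on \<open>J S J\<close> in
    the middle.\<close>
  have "S = J ** J ** S ** (J ** J)" by (simp add: J)
  also have "\<dots> = J ** (J ** S ** J) ** J" by (simp only: matrix_mul_assoc)
  also have "\<dots> = (transpose Q ** ?D ** Q) ** (J ** S ** J) ** (transpose Q ** ?D ** Q)"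
    by (simp only: 3)
  also have "\<dots> = transpose Q ** ?D ** (Q ** (J ** S ** J) ** transpose Q) ** ?D ** Q"
    by (simp only: matrix_mul_assoc)
  also have "\<dots> = transpose Q ** (?D ** diag_matrix (abs_vec l) ** ?D) ** Q"
    unfolding S[symmetric] by (simp only: matrix_mul_assoc)
  also have "?D ** diag_matrix (abs_vec l) ** ?D = diag_matrix (abs_vec l)"
    using l by (auto simp: diag_matrix_nth diag_matrix_mult abs_vec_def sgn_vec_def vec_eq_iff sgn_if)
  finally show ?thesis using Q l by (simp add: indef_factorization_def)
qed

text \<open>The rows of \<open>X\<close> are the images \<open>H *v U i\<close> under one matrix
  \<open>H\<close>. Orthonormality of the columns of \<open>U\<close> gives
  \<open>H H^T = S\<close>, comparing the two expressions for \<open>P\<close> gives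
  \<open>H^T J H = diag L\<close>, and \<open>Q\<close> is \<open>H^T\<close> with its rows divided
  by the roots of \<open>|L|\<close>.\<close>

lemma eigendecomposition_imp_factorization:
  assumes E: "eigendecomposition n (\<lambda>i k. x i \<bullet> (J *v x k)) U L"
    and J: "J ** J = mat 1" "transpose J = J"
    and S: "S = (\<Sum>i<n. outer_prod (x i) (x i))" "invertible S"
  shows "\<exists>Q. is_Q_matrix n x U L Q \<and> indef_factorization J S L Q"
proof -
  from E have P: "\<And>i k. i < n \<Longrightarrow> k < n \<Longrightarrow> x i \<bullet> (J *v x k) = U i \<bullet> (diag_matrix L *v U k)"
    and U: "(\<Sum>i<n. outer_prod (U i) (U i)) = mat 1"
    and L: "\<forall>j. L $ j \<noteq> 0" "\<forall>j k. j \<le> k \<longrightarrow> L $ k \<le> L $ j"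
    by (auto simp: eigendecomposition_def)
  obtain T where T: "T ** S = mat 1" using S(2) unfolding invertible_def by blast
  define B where "B = (\<Sum>k<n. outer_prod (x k) (U k))"
  \<comment> \<open>Multiplying \<open>X J X^T = U diag L U^T\<close> by \<open>X^T\<close> from the
    left gives \<open>S J x_i = B diag L U_i\<close> with \<open>B = X^T U\<close>; solving for
    \<open>x_i\<close> yields this \<open>H\<close>.\<close>
  define H where "H = J ** T ** B ** diag_matrix L"
  have x: "x i = H *v U i" if "i < n" for i
  proof -
    have "S *v (J *v x i) = (\<Sum>k<n. (x i \<bullet> (J *v x k)) *\<^sub>R x k)"
      unfolding S sum_outer_vector
      by (rule sum.cong, simp, subst inner_matrix_vector)
        (simp add: J inner_commute del: transpose_matrix_vector)
    also have "\<dots> = (\<Sum>k<n. (U k \<bullet> (diag_matrix L *v U i)) *\<^sub>R x k)"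
    proof (rule sum.cong)
      fix k assume "k \<in> {..<n}"
      then have "x i \<bullet> (J *v x k) = U i \<bullet> (diag_matrix L *v U k)" using P that by simp
      also have "\<dots> = U k \<bullet> (diag_matrix L *v U i)"
        by (subst inner_matrix_vector) (simp add: inner_commute del: transpose_matrix_vector)
      finally show "(x i \<bullet> (J *v x k)) *\<^sub>R x k = (U k \<bullet> (diag_matrix L *v U i)) *\<^sub>R x k" by simp
    qed simp
    also have "\<dots> = B *v (diag_matrix L *v U i)"
      by (simp add: B_def sum_outer_vector)
    finally have "J *v (T *v (S *v (J *v x i))) = J *v (T *v (B *v (diag_matrix L *v U i)))" by simp
    moreover have "T *v (S *v z) = z" "J *v (J *v z) = z" for z
      by (simp_all add: matrix_vector_mul_assoc T J)
    ultimately have "x i = J *v (T *v (B *v (diag_matrix L *v U i)))" by simp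
    then show ?thesis by (simp add: H_def matrix_vector_mul_assoc matrix_mul_assoc)
  qed
  have HH: "H ** transpose H = S"
  proof -
    have "H ** mat 1 ** transpose H = (\<Sum>i<n. outer_prod (H *v U i) (H *v U i))"
      by (simp only: sum_outer_congruence flip: U)
    also have "\<dots> = S" unfolding S by (rule sum.cong) (simp_all add: x)
    finally show ?thesis by simp
  qed
  have HJH: "transpose H ** J ** H = diag_matrix L"
  proof (rule matrix_eq_of_bilinear_eq[OF U])
    fix i k assume "i < n" "k < n"
    have "U i \<bullet> ((transpose H ** J ** H) *v U k) = (H *v U i) \<bullet> (J *v (H *v U k))"
      by (simp add: matrix_vector_mul_assoc[symmetric] inner_matrix_vector[of _ "transpose H"] del: transpose_matrix_vector)
    then show "U i \<bullet> ((transpose H ** J ** H) *v U k) = U i \<bullet> (diag_matrix L *v U k)"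
      by (simp add: \<open>i < n\<close> \<open>k < n\<close> P flip: x)
  qed
  define R where "R = diag_matrix (\<chi> j. 1 / sqrt \<bar>L $ j\<bar>)"
  define Q where "Q = R ** transpose H"
  have R1: "sqrt_abs_diag L ** R = mat 1"
    unfolding sqrt_abs_diag_def R_def diag_matrix_mult
    by (rule diag_matrix_1) (use L in simp)
  have R2: "R ** diag_matrix (abs_vec L) ** R = mat 1"
    unfolding R_def diag_matrix_mult
    by (rule diag_matrix_1) (use L in \<open>simp add: abs_vec_def flip: mult.assoc\<close>)
  have R3: "R ** diag_matrix L ** R = diag_matrix (sgn_vec L)"
    unfolding R_def diag_matrix_mult
    by (rule arg_cong[where f=diag_matrix])
      (use L in \<open>auto simp add: sgn_vec_def vec_eq_iff sgn_if field_simps\<close>)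
  have RT: "transpose R = R" by (simp add: R_def)
  have "is_Q_matrix n x U L Q"
    unfolding is_Q_matrix_def Q_def matrix_mul_assoc R1 by (simp add: x)
  moreover have "Q ** J ** transpose Q = diag_matrix (sgn_vec L)"
    unfolding Q_def matrix_transpose_mul transpose_transpose RT
    by (simp only: HJH R3 flip: matrix_mul_assoc) (simp only: HJH R3 matrix_mul_assoc)
  moreover have "transpose Q ** diag_matrix (abs_vec L) ** Q = S"
    unfolding Q_def matrix_transpose_mul transpose_transpose RT
    by (simp only: HH flip: matrix_mul_assoc) (metis HH R2 matrix_mul_assoc matrix_mul_rid)
  ultimately show ?thesis using L by (auto simp: indef_factorization_def)
qed

text \<open>The requirement \<open>U |L|^(1/2) Q = X\<close> forces the rows of \<open>U\<close> to
  be \<open>G *v x i\<close>, with \<open>G\<close> the inverse of \<open>Q^T |L|^(1/2)\<close>. The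
  equation for \<open>S\<close> then makes the columns orthonormal, and the one for \<open>J\<close>
  reproduces \<open>P\<close>.\<close>

lemma factorization_imp_eigendecomposition:
  assumes R: "indef_factorization J S L Q"
    and J: "J ** J = mat 1" "transpose J = J"
    and S: "S = (\<Sum>i<n. outer_prod (x i) (x i))"
  shows "\<exists>U. eigendecomposition n (\<lambda>i k. x i \<bullet> (J *v x k)) U L"
proof -
  let ?D = "diag_matrix (sgn_vec L)"
  from R have L: "\<forall>j. L $ j \<noteq> 0" "\<forall>j k. j \<le> k \<longrightarrow> L $ k \<le> L $ j"
    and Q: "Q ** J ** transpose Q = ?D" "transpose Q ** diag_matrix (abs_vec L) ** Q = S"
    by (auto simp: indef_factorization_def)
  define R where "R = diag_matrix (\<chi> j. 1 / sqrt \<bar>L $ j\<bar>)"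
  have RT: "transpose R = R" by (simp add: R_def)
  have R2: "R ** diag_matrix (abs_vec L) ** R = mat 1"
    unfolding R_def diag_matrix_mult
    by (rule diag_matrix_1) (use L in \<open>simp add: abs_vec_def flip: mult.assoc\<close>)
  have R3: "R ** diag_matrix L ** R = ?D"
    unfolding R_def diag_matrix_mult
    by (rule arg_cong[where f=diag_matrix])
      (use L in \<open>auto simp add: sgn_vec_def vec_eq_iff sgn_if field_simps\<close>)
  \<comment> \<open>By the normalisation, \<open>sgn L Q J\<close> is a left inverse of
    \<open>Q^T\<close>.\<close>
  define G where "G = R ** ?D ** Q ** J"
  have DD: "?D ** ?D = mat 1" using L by (simp add: sgn_sgn_diag)
  have GS: "G ** S ** transpose G = mat 1"
  proof -
    have "G ** S ** transpose G =
      R ** ?D ** (Q ** J ** transpose Q) ** diag_matrix (abs_vec L) ** (Q ** J ** transpose Q) ** ?D ** R"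
      unfolding G_def matrix_transpose_mul RT J transpose_diag_matrix Q(2)[symmetric] 
      by (simp only: matrix_mul_assoc)
    also have "\<dots> = R ** (?D ** ?D) ** diag_matrix (abs_vec L) ** (?D ** ?D) ** R"
      by (simp only: Q matrix_mul_assoc)
    finally show ?thesis by (simp add: DD R2)
  qed
  have GL: "transpose G ** diag_matrix L ** G = J"
  proof -
    have "transpose G ** diag_matrix L ** G = J ** transpose Q ** ?D ** (R ** diag_matrix L ** R) ** ?D ** Q ** J"
      unfolding G_def matrix_transpose_mul RT J transpose_diag_matrix
      by (simp only: matrix_mul_assoc)
    also have "\<dots> = J ** (transpose Q ** (?D ** ?D) ** ?D ** Q) ** J"
      by (simp only: R3 matrix_mul_assoc)
    also have "\<dots> = J"
      using indef_factorization_inverse(2)[OF R J(1)] by (simp add: DD J)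
    finally show ?thesis .
  qed
  have "x i \<bullet> (J *v x k) = (G *v x i) \<bullet> (diag_matrix L *v (G *v x k))" for i k
    unfolding GL[symmetric]
    by (simp add: matrix_vector_mul_assoc[symmetric] inner_matrix_vector[of _ "transpose G"] del: transpose_matrix_vector)
  moreover have "(\<Sum>i<n. outer_prod (G *v x i) (G *v x i)) = mat 1"
    using GS by (simp add: S sum_outer_congruence)
  ultimately have "eigendecomposition n (\<lambda>i k. x i \<bullet> (J *v x k)) (\<lambda>i. G *v x i) L"
    using L by (auto simp: eigendecomposition_def)
  then show ?thesis by blast
qed

section \<open>Existence of factorizations\<close>

definition pos_def :: "('d :: finite) rmat \<Rightarrow> bool" where
  "pos_def S \<longleftrightarrow> transpose S = S \<and> (\<forall>y. y \<noteq> 0 \<longrightarrow> 0 < y \<bullet> (S *v y))"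

lemma symmetric_inner:
  fixes S :: "('d :: finite) rmat"
  assumes "transpose S = S"
  shows "y \<bullet> (S *v z) = z \<bullet> (S *v y)"
proof -
  have "y \<bullet> (S *v z) = (transpose S *v y) \<bullet> z" by (rule inner_matrix_vector)
  then show ?thesis using assms by (simp add: inner_commute)
qed

text \<open>The constant is the minimum of the form on the compact unit sphere; homogeneity does the
  rest.\<close>

lemma pos_def_coercive:
  assumes "pos_def S"
  obtains c where "c > 0" "\<And>y. c * (norm y)\<^sup>2 \<le> y \<bullet> (S *v y)"
proof -
  have "\<exists>x\<in>sphere 0 1. \<forall>y\<in>sphere 0 1. x \<bullet> (S *v x) \<le> y \<bullet> (S *v y)"
  proof (rule continuous_attains_inf)
    have "axis undefined 1 \<in> (sphere 0 1 :: 'a rvec set)" by simp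
    then show "sphere 0 1 \<noteq> ({} :: 'a rvec set)" by blast
    show "continuous_on (sphere 0 1) (\<lambda>y. y \<bullet> (S *v y))"
      by (intro continuous_intros linear_continuous_on matrix_vector_mul_bounded_linear)
  qed simp
  then obtain x where x: "norm x = 1" and min: "\<And>y. norm y = 1 \<Longrightarrow> x \<bullet> (S *v x) \<le> y \<bullet> (S *v y)"
    by auto
  show thesis
  proof
    have "x \<noteq> 0" using x by auto
    then show "x \<bullet> (S *v x) > 0" using assms by (simp add: pos_def_def)
    show "x \<bullet> (S *v x) * (norm y)\<^sup>2 \<le> y \<bullet> (S *v y)" for y
    proof (cases "y = 0")
      case False
      have "y \<bullet> (S *v y) = (norm y *\<^sub>R sgn y) \<bullet> (S *v (norm y *\<^sub>R sgn y))"
        using False by (simp add: sgn_div_norm)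
      also have "\<dots> = (norm y)\<^sup>2 * (sgn y \<bullet> (S *v sgn y))"
        by (simp only: matrix_vector_mult_scaleR inner_scaleR_left inner_scaleR_right power2_eq_square mult.assoc)
      finally have "y \<bullet> (S *v y) = (norm y)\<^sup>2 * (sgn y \<bullet> (S *v sgn y))" .
      then show ?thesis using min[of "sgn y"] False by (simp add: norm_sgn mult.commute mult_left_mono)
    qed simp
  qed
qed

text \<open>For a small \<open>t\<close> with the sign of \<open>b\<close> the linear term would
  dominate. This is the first-order condition at a maximum.\<close>

lemma linear_le_quadratic_imp_zero:
  fixes b k :: real
  assumes "\<And>t. 2 * t * b \<le> t\<^sup>2 * k"
  shows "b = 0"
proof (rule ccontr)
  assume "b \<noteq> 0"
  let ?m = "\<bar>k\<bar> + 1"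
  define t where "t = b / ?m"
  have "t \<noteq> 0" "b = t * ?m" using \<open>b \<noteq> 0\<close> by (auto simp: t_def)
  have "t\<^sup>2 * (2 * ?m) \<le> t\<^sup>2 * k"
    using assms[of t] by (subst (asm) \<open>b = t * ?m\<close>) (simp add: power2_eq_square mult_ac)
  then have "2 * ?m \<le> k" using \<open>t \<noteq> 0\<close> by simp
  then show False using abs_ge_self[of k] abs_ge_zero[of k] by argo
qed

text \<open>The vector maximising the second form on the unit sphere of the first one is orthogonal, for
  both forms, to the hyperplane on which the induction continues.\<close>

lemma simultaneous_diagonalisation_subspace:
  fixes S K :: "('d :: finite) rmat"
  assumes S: "pos_def S" and K: "transpose K = K" and "subspace V"
  shows "\<exists>B. finite B \<and> B \<subseteq> V \<and> card B = dim V \<and> (\<forall>y\<in>B. y \<bullet> (S *v y) = 1) \<and>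
    (\<forall>y\<in>B. \<forall>z\<in>B. y \<noteq> z \<longrightarrow> y \<bullet> (S *v z) = 0 \<and> y \<bullet> (K *v z) = 0)"
  using \<open>subspace V\<close>
proof (induction "dim V" arbitrary: V)
  case 0
  then show ?case by (intro exI[of _ "{}"]) simp
next
  case (Suc n)
  have Ss: "y \<bullet> (S *v z) = z \<bullet> (S *v y)" for y z
    using S by (intro symmetric_inner) (simp add: pos_def_def)
  have Ks: "y \<bullet> (K *v z) = z \<bullet> (K *v y)" for y z
    using K by (rule symmetric_inner)
  obtain c where c: "c > 0" "\<And>y. c * (norm y)\<^sup>2 \<le> y \<bullet> (S *v y)"
    using pos_def_coercive[OF S] by blast
  define C where "C = {y \<in> V. y \<bullet> (S *v y) = 1}"
  have cont: "continuous_on A (\<lambda>y. y \<bullet> (T *v y))" for T :: "'d rmat" and A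
    by (intro continuous_intros linear_continuous_on matrix_vector_mul_bounded_linear)
  have normalise: "(1 / sqrt (y \<bullet> (S *v y))) *\<^sub>R y \<in> C" if "y \<in> V" "y \<noteq> 0" for y
    using that S Suc.prems
    by (auto simp: C_def pos_def_def subspace_scale matrix_vector_mult_scaleR real_sqrt_mult_self
        less_imp_le simp flip: power2_eq_square mult.assoc)
  have "\<exists>y0\<in>C. \<forall>y\<in>C. y \<bullet> (K *v y) \<le> y0 \<bullet> (K *v y0)"
  proof (rule continuous_attains_sup)
    have "closed C"
    proof -
      have "C = V \<inter> (\<lambda>y. y \<bullet> (S *v y)) -` {1}" by (auto simp: C_def)
      moreover have "closed ((\<lambda>y. y \<bullet> (S *v y)) -` {1})"
        using continuous_closed_vimage[OF closed_singleton, of "\<lambda>y. y \<bullet> (S *v y)"] cont[of UNIV S]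
        by (simp add: continuous_on_eq_continuous_at)
      ultimately show ?thesis using closed_subspace[OF Suc.prems] by auto
    qed
    moreover have "bounded C"
      unfolding bounded_iff
    proof (intro exI ballI)
      fix y assume "y \<in> C"
      then have "c * (norm y)\<^sup>2 \<le> 1" using c(2)[of y] by (simp add: C_def)
      then have "(norm y)\<^sup>2 \<le> 1 / c" using c(1) by (simp add: field_simps)
      then show "norm y \<le> sqrt (1 / c)" by (simp add: real_le_rsqrt)
    qed
    ultimately show "compact C" by (simp add: compact_eq_bounded_closed)
    have "\<not> V \<subseteq> {0}" using Suc.hyps(2) by (metis dim_eq_0 nat.distinct(1))
    then show "C \<noteq> {}" using normalise by blast
  qed (rule cont)
  then obtain y0 where y0: "y0 \<in> C" and max: "\<And>y. y \<in> C \<Longrightarrow> y \<bullet> (K *v y) \<le> y0 \<bullet> (K *v y0)"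
    by blast
  define m where "m = y0 \<bullet> (K *v y0)"
  have y0V: "y0 \<in> V" "y0 \<bullet> (S *v y0) = 1" using y0 by (auto simp: C_def)
  \<comment> \<open>Homogeneity extends the maximality of \<open>y0\<close> from the normalised
    vectors to an inequality of forms on \<open>V\<close>.\<close>
  have le: "y \<bullet> (K *v y) \<le> m * (y \<bullet> (S *v y))" if "y \<in> V" for y
  proof (cases "y = 0")
    case False
    then have pos: "0 < y \<bullet> (S *v y)" using S by (auto simp: pos_def_def)
    have "(1 / sqrt (y \<bullet> (S *v y)))\<^sup>2 * (y \<bullet> (K *v y)) \<le> m"
      using max[OF normalise[OF that False]] 
      by (simp add: m_def matrix_vector_mult_scaleR power2_eq_square)
    then show ?thesis using pos by (simp add: power_divide field_simps)
  qed simp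
  \<comment> \<open>The inequality \<open>le\<close> along \<open>y0 + t *\<^sub>R z\<close> is an
    equality at \<open>t = 0\<close>, so the coefficient linear in \<open>t\<close>
    vanishes.\<close>
  have orth: "y0 \<bullet> (K *v z) = 0" if "z \<in> V" "y0 \<bullet> (S *v z) = 0" for z
  proof (rule linear_le_quadratic_imp_zero)
    fix t :: real
    have "y0 + t *\<^sub>R z \<in> V" using that y0V Suc.prems by (simp add: subspace_add subspace_scale)
    from le[OF this] have "m + 2 * t * (y0 \<bullet> (K *v z)) + t\<^sup>2 * (z \<bullet> (K *v z)) \<le> m * (1 + t\<^sup>2 * (z \<bullet> (S *v z)))"
      using that(2) Ss[of z y0] Ks[of z y0] y0V(2)
      by (simp add: matrix_vector_right_distrib matrix_vector_mult_scaleR inner_add_left inner_add_right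
          power2_eq_square m_def algebra_simps)
    then show "2 * t * (y0 \<bullet> (K *v z)) \<le> t\<^sup>2 * (m * (z \<bullet> (S *v z)) - z \<bullet> (K *v z))"
      by (simp add: algebra_simps)
  qed
  define W where "W = {z \<in> V. y0 \<bullet> (S *v z) = 0}"
  have W: "subspace W"
    using Suc.prems by (auto simp: W_def subspace_def matrix_vector_right_distrib matrix_vector_mult_scaleR inner_add_right)
  have "y0 \<notin> span W" using W y0V by (simp add: span_eq_iff[THEN iffD2] W_def)
  then have "dim (insert y0 W) = dim W + 1" by (simp add: dim_insert)
  \<comment> \<open>Removing from a vector its component along \<open>y0\<close>, measured by the
    form of \<open>S\<close>, leaves an element of \<open>W\<close>; so the dimension drops by
    exactly one.\<close>
  moreover have "span (insert y0 W) = V"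
  proof (rule span_unique)
    show "insert y0 W \<subseteq> V" using y0V by (auto simp: W_def)
    show "V \<subseteq> T" if "insert y0 W \<subseteq> T" "subspace T" for T
    proof
      fix v assume v: "v \<in> V"
      have "v - (y0 \<bullet> (S *v v)) *\<^sub>R y0 \<in> W"
        using v y0V Suc.prems
        by (simp add: W_def subspace_diff subspace_scale matrix_vector_mult_diff_distrib
            matrix_vector_mult_scaleR inner_diff_right)
      then have "(v - (y0 \<bullet> (S *v v)) *\<^sub>R y0) + (y0 \<bullet> (S *v v)) *\<^sub>R y0 \<in> T"
        using that by (intro subspace_add subspace_scale) auto
      then show "v \<in> T" by simp
    qed
  qed (rule Suc.prems)
  ultimately have "n = dim W" using Suc.hyps(2) by (metis Suc_eq_plus1 Suc_inject dim_span)
  from Suc.hyps(1)[OF this W] obtain B where B: "finite B" "B \<subseteq> W" "card B = dim W"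
    "\<And>y. y \<in> B \<Longrightarrow> y \<bullet> (S *v y) = 1"
    "\<And>y z. y \<in> B \<Longrightarrow> z \<in> B \<Longrightarrow> y \<noteq> z \<Longrightarrow> y \<bullet> (S *v z) = 0 \<and> y \<bullet> (K *v z) = 0"
    by blast
  have "y0 \<notin> B" using B(2) y0V by (auto simp: W_def)
  moreover have "y0 \<bullet> (S *v z) = 0 \<and> y0 \<bullet> (K *v z) = 0 \<and> z \<bullet> (S *v y0) = 0 \<and> z \<bullet> (K *v y0) = 0" if "z \<in> B" for z
    using that B(2) orth[of z] Ss[of z y0] Ks[of z y0] by (auto simp: W_def)
  ultimately show ?case
    using B y0V \<open>n = dim W\<close> Suc.hyps(2) by (intro exI[of _ "insert y0 B"]) (auto simp: W_def)
qed

text \<open>Rank is strictly increasing, hence injective, and its values lie in a set of the same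
  size. It lets list positions and counting arguments act on the index type.\<close>

lemma rank_bij: "bij_betw (\<lambda>j :: 'd :: {finite, linorder}. card {k. k < j}) UNIV {..<CARD('d)}"
proof -
  have mono: "card {k. k < i} < card {k. k < j}" if "i < j" for i j :: 'd
    using that by (intro psubset_card_mono) auto
  have inj: "inj (\<lambda>j :: 'd. card {k. k < j})"
    by (rule injI) (metis mono less_irrefl neqE)
  have "(\<lambda>j :: 'd. card {k. k < j}) ` UNIV \<subseteq> {..<CARD('d)}"
    by (auto intro!: psubset_card_mono)
  moreover from inj have "card ((\<lambda>j :: 'd. card {k. k < j}) ` UNIV) = card {..<CARD('d)}"
    by (simp add: card_image)
  ultimately have "(\<lambda>j :: 'd. card {k. k < j}) ` UNIV = {..<CARD('d)}"
    by (intro card_subset_eq) auto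
  with inj show ?thesis by (simp add: bij_betw_def)
qed

text \<open>A list sorted by the negated key is decreasing in \<open>f\<close>; reading it at the
  rank of the index gives the order required of eigenvalues.\<close>

lemma sorted_enumeration:
  fixes f :: "'b \<Rightarrow> real"
  assumes "finite B" "card B = CARD('d)"
  obtains g :: "'d :: {finite, linorder} \<Rightarrow> 'b" where "bij_betw g UNIV B" "\<And>j k. j \<le> k \<Longrightarrow> f (g k) \<le> f (g j)"
proof -
  obtain ys where ys: "set ys = B" "distinct ys" using finite_distinct_list[OF assms(1)] by blast
  define xs where "xs = sort_key (\<lambda>y. - f y) ys"
  have xs: "set xs = B" "distinct xs" "sorted (map (\<lambda>y. - f y) xs)" using ys by (simp_all add: xs_def)
  then have len: "length xs = CARD('d)" using assms(2) distinct_card by metis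
  show thesis
  proof
    show "bij_betw (\<lambda>j :: 'd. xs ! card {k. k < j}) UNIV B"
      using bij_betw_trans[OF rank_bij bij_betw_nth[OF xs(2), of "{..<CARD('d)}" B]] len xs(1)
      by (simp add: comp_def)
    fix j k :: 'd assume "j \<le> k"
    then have "card {i. i < j} \<le> card {i. i < k}" by (intro card_mono) auto
    moreover have "card {i. i < k} < length xs" using rank_bij[where 'd='d] len by (auto simp: bij_betw_def)
    ultimately show "f (xs ! card {i. i < k}) \<le> f (xs ! card {i. i < j})"
      using sorted_nth_mono[OF xs(3), of "card {i. i < j}" "card {i. i < k}"] by simp
  qed
qed

lemma row_congruence_nth:
  "(Y ** A ** transpose Y) $ i $ j = Y $ i \<bullet> (A *v Y $ j)" for A Y :: "('d :: finite) rmat"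
proof -
  have "(Y ** A ** transpose Y) $ i $ j = (\<Sum>k\<in>UNIV. \<Sum>l\<in>UNIV. Y $ i $ l * (A $ l $ k * Y $ j $ k))"
    by (simp add: matrix_matrix_mult_def transpose_def sum_distrib_right mult.assoc)
  also have "\<dots> = Y $ i \<bullet> (A *v Y $ j)"
    by (subst sum.swap) (simp add: inner_vec_def matrix_vector_mult_def sum_distrib_left)
  finally show ?thesis .
qed

text \<open>A basis orthonormal for \<open>J S J\<close> and orthogonal for \<open>J\<close> has
  values \<open>g j \<bullet> (J *v g j)\<close> that are the reciprocals of the eigenvalues.
  Scaling row \<open>j\<close> by \<open>sqrt \<bar>l $ j\<bar>\<close> turns them into signs, and
  turns the unit values of the first form into \<open>|l|\<close>.\<close>

lemma indef_factorization_exists: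
  fixes S J :: "('d :: {finite, linorder}) rmat"
  assumes S: "pos_def S" and J: "J ** J = mat 1" "transpose J = J"
  shows "\<exists>l Q. indef_factorization J S l Q"
proof -
  have JJ: "J *v (J *v z) = z" for z by (simp add: matrix_vector_mul_assoc J)
  have J0: "J *v y \<noteq> 0" if "y \<noteq> 0" for y using JJ[of y] that by (metis matrix_vector_mult_0_right)
  define S' where "S' = J ** S ** J"
  have S': "pos_def S'"
    unfolding pos_def_def
  proof (intro conjI allI impI)
    show "transpose S' = S'" using S J by (simp add: S'_def pos_def_def matrix_transpose_mul matrix_mul_assoc)
    fix y :: "'d rvec" assume "y \<noteq> 0"
    then have "0 < (J *v y) \<bullet> (S *v (J *v y))" using S J0 by (auto simp: pos_def_def)
    also have "\<dots> = y \<bullet> (S' *v y)"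
      unfolding S'_def matrix_vector_mul_assoc[symmetric] using symmetric_inner[OF J(2), of y "S *v (J *v y)"]
      by (simp add: inner_commute)
    finally show "0 < y \<bullet> (S' *v y)" .
  qed
  obtain B where B: "finite B" "card B = CARD('d)" "\<And>y. y \<in> B \<Longrightarrow> y \<bullet> (S' *v y) = 1"
    "\<And>y z. y \<in> B \<Longrightarrow> z \<in> B \<Longrightarrow> y \<noteq> z \<Longrightarrow> y \<bullet> (S' *v z) = 0 \<and> y \<bullet> (J *v z) = 0"
    using simultaneous_diagonalisation_subspace[OF S' J(2) subspace_UNIV] by (auto simp: dim_UNIV)
  obtain g :: "'d \<Rightarrow> 'd rvec" where g: "bij_betw g UNIV B"
    and sorted: "\<And>j k. j \<le> k \<Longrightarrow> 1 / (g k \<bullet> (J *v g k)) \<le> 1 / (g j \<bullet> (J *v g j))"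
    using sorted_enumeration[OF B(1,2), of "\<lambda>y. 1 / (y \<bullet> (J *v y))"] by blast
  have gB: "g j \<in> B" for j using g by (auto simp: bij_betw_def)
  have g_neq: "g i \<noteq> g j" if "i \<noteq> j" for i j using g that by (auto simp: bij_betw_def inj_def)
  define Y where "Y = (\<chi> j. g j)"
  define l where "l = (\<chi> j. 1 / (g j \<bullet> (J *v g j)))"
  have YS: "Y ** S' ** transpose Y = mat 1"
    using B(3)[OF gB] B(4)[OF gB gB g_neq] unfolding Y_def vec_eq_iff row_congruence_nth by (simp add: mat_def)
  then have "(S' ** transpose Y) ** Y = mat 1"
    by (metis matrix_left_right_inverse matrix_mul_assoc)
  \<comment> \<open>A zero value would make \<open>J *v g j\<close> orthogonal to every row of the
    invertible matrix \<open>Y\<close>.\<close>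
  have f: "g j \<bullet> (J *v g j) \<noteq> 0" for j
  proof
    assume 0: "g j \<bullet> (J *v g j) = 0"
    have "g i \<bullet> (J *v g j) = 0" for i
      using 0 B(4)[OF gB gB g_neq, of i j] by (cases "i = j") auto
    then have "Y *v (J *v g j) = 0" by (simp add: Y_def matrix_mult_dot vec_eq_iff)
    then have "(S' ** transpose Y) *v (Y *v (J *v g j)) = 0" by simp
    then have "J *v g j = 0" unfolding matrix_vector_mul_assoc
      by (metis \<open>(S' ** transpose Y) ** Y = mat 1\<close> matrix_mul_assoc matrix_mul_lid)
    then have "g j = 0" using J0 by blast
    then show False using B(3)[OF gB, of j] by simp
  qed
  have YJ: "Y ** J ** transpose Y = diag_matrix (\<chi> j. 1 / l $ j)"
    using B(4)[OF gB gB g_neq] unfolding Y_def vec_eq_iff row_congruence_nth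
    by (auto simp: diag_matrix_nth l_def)
  define R where "R = diag_matrix (\<chi> j. sqrt \<bar>l $ j\<bar>)"
  have RT: "transpose R = R" by (simp add: R_def)
  have l0: "\<forall>j. l $ j \<noteq> 0" using f by (simp add: l_def)
  have "indef_factorization J S l (R ** Y)"
  proof (rule indef_factorizationI[OF J(1)])
    have "R ** Y ** J ** transpose (R ** Y) = R ** (Y ** J ** transpose Y) ** R"
      by (simp only: matrix_transpose_mul RT matrix_mul_assoc)
    also have "\<dots> = diag_matrix (sgn_vec l)"
      unfolding YJ R_def diag_matrix_mult
      by (rule arg_cong[where f=diag_matrix]) (use l0 in \<open>auto simp: sgn_vec_def vec_eq_iff sgn_if field_simps\<close>)
    finally show "R ** Y ** J ** transpose (R ** Y) = diag_matrix (sgn_vec l)" .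
    have "R ** Y ** (J ** S ** J) ** transpose (R ** Y) = R ** (Y ** S' ** transpose Y) ** R"
      by (simp only: S'_def matrix_transpose_mul RT matrix_mul_assoc)
    also have "\<dots> = diag_matrix (abs_vec l)"
      unfolding YS R_def matrix_mul_rid diag_matrix_mult
      by (rule arg_cong[where f=diag_matrix]) (simp add: abs_vec_def vec_eq_iff)
    finally show "R ** Y ** (J ** S ** J) ** transpose (R ** Y) = diag_matrix (abs_vec l)" .
    show "\<forall>j k. j \<le> k \<longrightarrow> l $ k \<le> l $ j" using sorted by (simp add: l_def)
  qed (rule l0)
  then show ?thesis by blast
qed

section \<open>Eigenvalues, uniqueness and convergence of factorizations\<close>

lemma map_matrix_of_real_mult:
  "map_matrix complex_of_real (A ** B) = map_matrix complex_of_real A ** map_matrix complex_of_real B"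
  by (simp add: vec_eq_iff matrix_matrix_mult_def)

text \<open>In the coordinates given by the inverse of \<open>V\<close> the eigenvector equation is
  diagonal, and any nonzero coordinate identifies the eigenvalue.\<close>

lemma complex_eigenvalues_diagonalised:
  fixes A V :: "('d :: finite) rmat"
  assumes AV: "A ** V = V ** diag_matrix l" and V: "invertible V"
  shows "complex_eigenvalues A \<subseteq> complex_of_real ` range (($) l)"
proof
  fix z assume "z \<in> complex_eigenvalues A"
  then obtain v :: "complex ^ 'd" where v: "v \<noteq> 0" "map_matrix complex_of_real A *v v = z *s v"
    by (auto simp: complex_eigenvalues_def)
  from V obtain W where W: "W ** V = mat 1" "V ** W = mat 1" by (auto simp: invertible_def)
  define u where "u = map_matrix complex_of_real W *v v"
  have one: "map_matrix complex_of_real (mat 1) = (mat 1 :: complex ^ 'd ^ 'd)"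
    by (simp add: vec_eq_iff mat_def)
  have "map_matrix complex_of_real V *v u = v"
    by (simp add: u_def matrix_vector_mul_assoc W one flip: map_matrix_of_real_mult)
  then have "u \<noteq> 0" using v(1) by auto
  then obtain j where j: "u $ j \<noteq> 0" by (auto simp: vec_eq_iff)
  have "W ** A = W ** (A ** V) ** W" by (simp add: W flip: matrix_mul_assoc)
  also have "\<dots> = diag_matrix l ** W" by (simp add: AV W matrix_mul_assoc)
  finally have WA: "W ** A = diag_matrix l ** W" .
  have "z *s u = map_matrix complex_of_real W *v (map_matrix complex_of_real A *v v)"
    unfolding v(2) u_def by (simp add: vector_scalar_commute)
  also have "\<dots> = map_matrix complex_of_real (diag_matrix l) *v u"
    by (simp add: u_def matrix_vector_mul_assoc WA flip: map_matrix_of_real_mult)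
  finally have "z * u $ j = (map_matrix complex_of_real (diag_matrix l) *v u) $ j"
    by (simp add: vec_eq_iff)
  also have "\<dots> = (\<Sum>i\<in>UNIV. (if j = i then complex_of_real (l $ j) else 0) * u $ i)"
    by (auto simp: matrix_vector_mult_def diag_matrix_nth intro!: sum.cong)
  also have "\<dots> = complex_of_real (l $ j) * u $ j"
    by (simp add: mult_delta_left)
  finally show "z \<in> complex_of_real ` range (($) l)" using j by auto
qed

text \<open>The number of larger values in the range equals the rank of the index, so range and rank
  determine each value.\<close>

lemma strictly_decreasing_eqI:
  fixes f g :: "'d :: {finite, linorder} \<Rightarrow> real"
  assumes f: "\<And>j k. j < k \<Longrightarrow> f k < f j" and g: "\<And>j k. j < k \<Longrightarrow> g k < g j"
    and range: "range f = range g"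
  shows "f = g"
proof
  have rank: "card {e \<in> range h. h j < e} = card {k. k < j}"
    if "\<And>j k. j < k \<Longrightarrow> h k < h j" for h :: "'d \<Rightarrow> real" and j
  proof -
    have "inj h" by (rule injI) (metis that less_irrefl neqE)
    moreover have "{e \<in> range h. h j < e} = h ` {k. k < j}"
      using that by (auto simp: image_iff) (metis less_asym less_irrefl neqE)
    ultimately show ?thesis by (metis card_image inj_on_subset subset_UNIV)
  qed
  fix j
  obtain k where k: "f j = g k" using range by (metis rangeE rangeI)
  have "card {i. i < j} = card {i. i < k}"
    using rank[of f j, OF f] rank[of g k, OF g] range k by simp
  then have "j = k" using rank_bij by (metis (mono_tags) UNIV_I bij_betw_def inj_onD)
  then show "f j = g j" using k by simp
qed

lemma indef_factorization_invertible:
  assumes R: "indef_factorization J S l Q" and J: "J ** J = mat 1"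
  shows "invertible Q"
  using indef_factorization_inverse(1,3)[OF assms] unfolding invertible_def by blast

text \<open>All \<open>d\<close> complex eigenvalues occur among the \<open>d\<close> entries of
  \<open>l\<close>. Counting leaves no room for a repeated or an extra entry, so the decreasing
  order is strict.\<close>

lemma indef_factorization_eigenvalues:
  fixes J S :: "('d :: {finite, linorder}) rmat"
  assumes R: "indef_factorization J S l Q" and J: "J ** J = mat 1"
    and distinct: "distinct_eigenvalues (S ** J)"
  shows "complex_of_real ` range (($) l) = complex_eigenvalues (S ** J)"
    and "j < k \<Longrightarrow> l $ k < l $ j"
proof -
  have sub: "complex_eigenvalues (S ** J) \<subseteq> complex_of_real ` range (($) l)"
    by (rule complex_eigenvalues_diagonalised[OF indef_factorization_eigen[OF R]])
      (simp add: transpose_invertible indef_factorization_invertible[OF R J])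
  have card: "card (complex_of_real ` range (($) l)) = card (range (($) l))"
    by (intro card_image) (simp add: inj_on_def)
  have le: "card (range (($) l)) \<le> CARD('d)" by (simp add: card_image_le)
  have ge: "CARD('d) \<le> card (range (($) l))"
    using card_mono[OF _ sub] distinct card by (simp add: distinct_eigenvalues_def)
  show "complex_of_real ` range (($) l) = complex_eigenvalues (S ** J)"
    using card_subset_eq[OF _ sub] distinct le ge card by (simp add: distinct_eigenvalues_def)
  have "inj (($) l)" using le ge by (intro eq_card_imp_inj_on) simp_all
  then show "l $ k < l $ j" if "j < k"
    using R that unfolding indef_factorization_def
    by (metis injD less_irrefl order_le_less)
qed

text \<open>Both vectors of eigenvalues enumerate the same spectrum in decreasing order. The matrix
  \<open>C\<close> with \<open>Q' = C Q\<close> then commutes with a diagonal matrix of distinct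
  entries, hence is diagonal, and the common normalisation makes its entries square to 1.\<close>

lemma indef_factorization_unique:
  fixes J S :: "('d :: {finite, linorder}) rmat"
  assumes R: "indef_factorization J S l Q" and R': "indef_factorization J S l' Q'"
    and J: "J ** J = mat 1" and distinct: "distinct_eigenvalues (S ** J)"
  shows "\<exists>s. (\<forall>j. s $ j \<in> {-1, 1}) \<and> Q' = diag_matrix s ** Q"
proof -
  note lt = indef_factorization_eigenvalues(2)[OF R J distinct]
  have "complex_of_real ` range (($) l) = complex_of_real ` range (($) l')"
    using indef_factorization_eigenvalues(1)[OF R J distinct] indef_factorization_eigenvalues(1)[OF R' J distinct]
    by simp
  then have "range (($) l) = range (($) l')" by (simp add: inj_image_eq_iff inj_on_def)
  from strictly_decreasing_eqI[OF lt indef_factorization_eigenvalues(2)[OF R' J distinct] this]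
  have l': "l' = l" by (auto simp: vec_eq_iff)
  obtain W where W: "W ** Q = mat 1" "Q ** W = mat 1"
    using indef_factorization_invertible[OF R J] by (auto simp: invertible_def)
  define C where "C = Q' ** W"
  have Q': "Q' = C ** Q" by (simp add: C_def W flip: matrix_mul_assoc)
  have TW: "transpose W ** transpose Q = mat 1"
    by (metis W(2) matrix_transpose_mul transpose_mat)
  have eig: "S ** J ** transpose Q = transpose Q ** diag_matrix l"
    by (rule indef_factorization_eigen[OF R])
  have "S ** J ** transpose Q ** transpose C = transpose Q ** transpose C ** diag_matrix l"
    using indef_factorization_eigen[OF R'] by (simp add: Q' l' matrix_transpose_mul matrix_mul_assoc)
  then have "transpose Q ** (diag_matrix l ** transpose C) = transpose Q ** (transpose C ** diag_matrix l)"
    by (simp add: eig matrix_mul_assoc)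
  then have "transpose W ** (transpose Q ** (diag_matrix l ** transpose C)) = transpose W ** (transpose Q ** (transpose C ** diag_matrix l))"
    by simp
  then have comm: "diag_matrix l ** transpose C = transpose C ** diag_matrix l"
    unfolding matrix_mul_assoc TW by simp
  have off: "C $ j $ i = 0" if "i \<noteq> j" for i j
  proof -
    have "l $ i * C $ j $ i = C $ j $ i * l $ j"
      using comm by (metis diag_matrix_left_nth diag_matrix_right_nth transpose_nth)
    moreover have "l $ i \<noteq> l $ j" using lt that by (metis less_irrefl neqE)
    ultimately show ?thesis by auto
  qed
  define s where "s = (\<chi> j. C $ j $ j)"
  have C: "C = diag_matrix s" using off by (auto simp: vec_eq_iff diag_matrix_nth s_def)
  have "diag_matrix (sgn_vec l) = C ** (Q ** J ** transpose Q) ** transpose C"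
    using R' unfolding indef_factorization_def Q' l' by (simp add: matrix_transpose_mul matrix_mul_assoc)
  also have "\<dots> = diag_matrix (s * sgn_vec l * s)"
    using R unfolding indef_factorization_def C by (simp add: diag_matrix_mult)
  finally have eq: "diag_matrix (sgn_vec l) = diag_matrix (s * sgn_vec l * s)" .
  have "s $ j \<in> {-1, 1}" for j
  proof -
    have "sgn (l $ j) = s $ j * sgn (l $ j) * s $ j"
      using arg_cong[OF eq, of "\<lambda>A. A $ j $ j"] by (simp add: diag_matrix_nth sgn_vec_def)
    moreover have "sgn (l $ j) \<noteq> 0" using R by (simp add: indef_factorization_def sgn_0_0)
    ultimately have "s $ j * s $ j = 1" by (metis mult.assoc mult.commute mult_cancel_left1)
    then show ?thesis by (auto simp: square_eq_1_iff)
  qed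
  then show ?thesis using Q' C by blast
qed

section \<open>Compactness: uniform bounds and limits of factorizations\<close>

text \<open>The eigenvector equation reduces the left side to the normalisation times
  \<open>diag l\<close>. Entrywise it expresses \<open>\<bar>l $ j\<bar>\<close> as a value of the
  form of \<open>S\<close>, whence the lower bound below.\<close>

lemma indef_factorization_abs:
  assumes R: "indef_factorization J S l Q"
  shows "Q ** (J ** S ** J) ** transpose Q = diag_matrix (abs_vec l)"
proof -
  have "Q ** (J ** S ** J) ** transpose Q = Q ** J ** (S ** J ** transpose Q)"
    by (simp only: matrix_mul_assoc)
  also have "\<dots> = Q ** J ** transpose Q ** diag_matrix l"
    by (simp only: indef_factorization_eigen[OF R] matrix_mul_assoc)
  also have "\<dots> = diag_matrix (abs_vec l)"
    using R by (simp add: indef_factorization_def abs_sgn_diag)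
  finally show ?thesis .
qed

lemma trace_congruence:
  "trace (transpose Q ** diag_matrix a ** Q) = (\<Sum>j\<in>UNIV. a $ j * (norm (Q $ j))\<^sup>2)" for Q :: "('d :: finite) rmat"
proof -
  have "trace (transpose Q ** diag_matrix a ** Q) = (\<Sum>i\<in>UNIV. \<Sum>j\<in>UNIV. Q $ j $ i * a $ j * Q $ j $ i)"
    unfolding trace_def by (simp add: matrix_matrix_mult_def[of _ Q] diag_matrix_right_nth transpose_nth)
  also have "\<dots> = (\<Sum>j\<in>UNIV. a $ j * (Q $ j \<bullet> Q $ j))"
    by (subst sum.swap) (simp add: inner_vec_def sum_distrib_left mult_ac)
  finally show ?thesis by (simp add: power2_norm_eq_inner)
qed

text \<open>\<open>J\<close> is an isometry, so the normalisation forces rows of norm at least 1,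
  and coercivity bounds \<open>|l|\<close> from below. The trace of \<open>Q^T |l| Q\<close> is the
  sum of \<open>\<bar>l $ j\<bar>\<close> times the squared row norms, which bounds both from
  above.\<close>

lemma indef_factorization_bounds:
  fixes J S :: "('d :: {finite, linorder}) rmat"
  assumes R: "indef_factorization J S l Q" and J: "J ** J = mat 1" "transpose J = J"
    and c: "c > 0" "\<And>y. c * (norm y)\<^sup>2 \<le> y \<bullet> (S *v y)"
  shows "c \<le> \<bar>l $ j\<bar>" "\<bar>l $ j\<bar> \<le> trace S" "(norm (Q $ j))\<^sup>2 \<le> trace S / c"
proof -
  have normJ: "norm (J *v y) = norm y" for y
  proof -
    have "(J *v y) \<bullet> (J *v y) = y \<bullet> (J *v (J *v y))"
      using symmetric_inner[OF J(2), of y "J *v y"] by simp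
    then show ?thesis by (simp add: matrix_vector_mul_assoc J norm_eq_sqrt_inner)
  qed
  have "Q $ i \<bullet> (J *v Q $ i) = sgn (l $ i)" for i
    using R unfolding indef_factorization_def by (metis row_congruence_nth diag_matrix_nth sgn_vec_def vec_lambda_beta)
  then have "1 = \<bar>Q $ i \<bullet> (J *v Q $ i)\<bar>" for i
    using R by (simp add: indef_factorization_def abs_sgn_eq)
  also have "\<bar>Q $ i \<bullet> (J *v Q $ i)\<bar> \<le> (norm (Q $ i))\<^sup>2" for i
    using Cauchy_Schwarz_ineq2[of "Q $ i" "J *v Q $ i"] by (simp add: normJ power2_eq_square)
  finally have ge1: "1 \<le> (norm (Q $ i))\<^sup>2" for i .
  have lower: "c * (norm (Q $ i))\<^sup>2 \<le> \<bar>l $ i\<bar>" for i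
  proof -
    have "\<bar>l $ i\<bar> = Q $ i \<bullet> ((J ** S ** J) *v Q $ i)"
      using indef_factorization_abs[OF R] by (metis row_congruence_nth diag_matrix_nth abs_vec_def vec_lambda_beta)
    also have "\<dots> = (J *v Q $ i) \<bullet> (S *v (J *v Q $ i))"
      unfolding matrix_vector_mul_assoc[symmetric]
      using symmetric_inner[OF J(2), of "Q $ i" "S *v (J *v Q $ i)"] by (simp add: inner_commute)
    finally show ?thesis using c(2)[of "J *v Q $ i"] by (simp add: normJ)
  qed
  have "c * 1 \<le> c * (norm (Q $ j))\<^sup>2" using c(1) ge1 by (intro mult_left_mono) auto
  then show "c \<le> \<bar>l $ j\<bar>" using lower[of j] by simp
  have "trace S = (\<Sum>i\<in>UNIV. \<bar>l $ i\<bar> * (norm (Q $ i))\<^sup>2)"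
    using R trace_congruence[of Q "abs_vec l"] by (simp add: indef_factorization_def abs_vec_def)
  also have "\<dots> \<ge> \<bar>l $ j\<bar> * (norm (Q $ j))\<^sup>2"
    by (intro member_le_sum) auto
  finally have "\<bar>l $ j\<bar> * (norm (Q $ j))\<^sup>2 \<le> trace S" .
  moreover have "\<bar>l $ j\<bar> * 1 \<le> \<bar>l $ j\<bar> * (norm (Q $ j))\<^sup>2" using ge1 by (intro mult_left_mono) auto
  ultimately show "\<bar>l $ j\<bar> \<le> trace S" by simp
  then have "c * (norm (Q $ j))\<^sup>2 \<le> trace S" using lower[of j] by simp
  then show "(norm (Q $ j))\<^sup>2 \<le> trace S / c" using c(1) by (simp add: field_simps)
qed

lemma tendsto_matrix_mult [tendsto_intros]:
  fixes A B :: "'b \<Rightarrow> ('d :: finite) rmat"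
  assumes "(A \<longlongrightarrow> a) F" "(B \<longlongrightarrow> b) F"
  shows "((\<lambda>n. A n ** B n) \<longlongrightarrow> a ** b) F"
proof (intro vec_tendstoI)
  show "((\<lambda>n. (A n ** B n) $ i $ j) \<longlongrightarrow> (a ** b) $ i $ j) F" for i j
    unfolding matrix_matrix_mult_def vec_lambda_beta
    by (intro tendsto_sum tendsto_mult tendsto_vec_nth assms)
qed

lemma tendsto_transpose [tendsto_intros]:
  fixes A :: "'b \<Rightarrow> ('d :: finite) rmat"
  assumes "(A \<longlongrightarrow> a) F"
  shows "((\<lambda>n. transpose (A n)) \<longlongrightarrow> transpose a) F"
proof (intro vec_tendstoI)
  show "((\<lambda>n. transpose (A n) $ i $ j) \<longlongrightarrow> transpose a $ i $ j) F" for i j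
    unfolding transpose_nth by (intro tendsto_vec_nth assms)
qed

lemma tendsto_diag_matrix [tendsto_intros]:
  assumes "(v \<longlongrightarrow> w) F"
  shows "((\<lambda>n. diag_matrix (v n)) \<longlongrightarrow> diag_matrix w) F"
proof (intro vec_tendstoI)
  fix i j
  show "((\<lambda>n. diag_matrix (v n) $ i $ j) \<longlongrightarrow> diag_matrix w $ i $ j) F"
    by (cases "i = j") (auto simp: diag_matrix_nth intro!: tendsto_intros assms)
qed

text \<open>The uniform lower bound keeps the limiting eigenvalues away from zero, where
  \<open>sgn\<close> would be discontinuous; the other conditions are closed.\<close>

lemma indef_factorization_limit:
  fixes J S :: "('d :: {finite, linorder}) rmat"
  assumes R: "\<And>n. indef_factorization J (T n) (l n) (Q n)"
    and lim: "T \<longlonglongrightarrow> S" "l \<longlonglongrightarrow> l'" "Q \<longlonglongrightarrow> Q'"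
    and c: "c > 0" "\<And>n j. c \<le> \<bar>l n $ j\<bar>"
  shows "indef_factorization J S l' Q'"
proof -
  have nth: "(\<lambda>n. l n $ j) \<longlonglongrightarrow> l' $ j" for j by (intro tendsto_intros lim)
  have nz: "l' $ j \<noteq> 0" for j
  proof -
    have "(\<lambda>n. \<bar>l n $ j\<bar>) \<longlonglongrightarrow> \<bar>l' $ j\<bar>" by (intro tendsto_intros nth)
    then have "c \<le> \<bar>l' $ j\<bar>" by (rule LIMSEQ_le_const) (use c in auto)
    then show ?thesis using c(1) by auto
  qed
  have "(\<lambda>n. sgn_vec (l n)) \<longlonglongrightarrow> sgn_vec l'" "(\<lambda>n. abs_vec (l n)) \<longlonglongrightarrow> abs_vec l'"
    unfolding sgn_vec_def abs_vec_def
    by (intro vec_tendstoI; simp add: tendsto_sgn tendsto_rabs nth nz)+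
  note d = this[THEN tendsto_diag_matrix]
  have "(\<lambda>n. Q n ** J ** transpose (Q n)) \<longlonglongrightarrow> Q' ** J ** transpose Q'"
    by (intro tendsto_intros lim)
  then have 1: "Q' ** J ** transpose Q' = diag_matrix (sgn_vec l')"
    using d(1) R unfolding indef_factorization_def by (metis (no_types, lifting) LIMSEQ_unique ext)
  have "(\<lambda>n. transpose (Q n) ** diag_matrix (abs_vec (l n)) ** Q n) \<longlonglongrightarrow> transpose Q' ** diag_matrix (abs_vec l') ** Q'"
    by (intro tendsto_matrix_mult tendsto_transpose d lim)
  then have 2: "transpose Q' ** diag_matrix (abs_vec l') ** Q' = S"
    using lim(1) R unfolding indef_factorization_def by (simp add: LIMSEQ_unique)
  have "l' $ k \<le> l' $ j" if "j \<le> k" for j k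
    by (rule LIMSEQ_le[OF nth nth]) (use R that in \<open>auto simp: indef_factorization_def\<close>)
  then show ?thesis using 1 2 nz by (simp add: indef_factorization_def)
qed

lemma norm_le_sum_norm_nth: "norm x \<le> (\<Sum>i\<in>UNIV. norm (x $ i))"
  unfolding norm_vec_def by (rule L2_set_le_sum) simp

lemma finite_sign_vectors: "finite {s :: ('d :: finite) rvec. \<forall>j. s $ j \<in> {-1, 1}}"
proof (rule finite_subset)
  show "{s :: 'd rvec. \<forall>j. s $ j \<in> {-1, 1}} \<subseteq> vec_lambda ` (UNIV \<rightarrow>\<^sub>E {-1, 1})"
  proof
    fix s :: "'d rvec" assume "s \<in> {s. \<forall>j. s $ j \<in> {-1, 1}}"
    then have "vec_nth s \<in> UNIV \<rightarrow>\<^sub>E {-1, 1}" by (auto simp: PiE_def Pi_def)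
    then show "s \<in> vec_lambda ` (UNIV \<rightarrow>\<^sub>E {-1, 1})" by (metis imageI vec_nth_inverse)
  qed
qed (auto intro!: finite_imageI finite_PiE)

lemma sign_diag_mult:
  assumes "\<forall>j. s $ j \<in> {-1, 1}"
  shows "diag_matrix s ** diag_matrix s = mat 1"
  unfolding diag_matrix_mult
proof (rule diag_matrix_1)
  show "(s * s) $ j = 1" for j using assms[rule_format, of j] by auto
qed

text \<open>Every subsequence of \<open>(l n, Q n)\<close> has a further subsequence converging to a factorization of
  the limit \<open>S\<close>, and these form a single orbit under sign changes.\<close>

lemma indef_factorization_convergence:
  fixes J S :: "('d :: {finite, linorder}) rmat"
  assumes R: "\<And>n. indef_factorization J (T n) (l n) (Q n)"
    and lim: "T \<longlonglongrightarrow> S"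
    and J: "J ** J = mat 1" "transpose J = J"
    and c: "c > 0" "\<And>n y. c * (norm y)\<^sup>2 \<le> y \<bullet> (T n *v y)"
    and R': "indef_factorization J S l' Q'"
    and distinct: "distinct_eigenvalues (S ** J)"
  shows "\<exists>s. (\<forall>n j. s n $ j \<in> {-1, 1}) \<and> (\<lambda>n. diag_matrix (s n) ** Q n) \<longlonglongrightarrow> Q'"
proof -
  let ?S = "{s :: 'd rvec. \<forall>j. s $ j \<in> {-1, 1}}"
  have "(\<chi> j. 1) \<in> ?S" by simp
  then have "?S \<noteq> {}" by blast
  \<comment> \<open>The signs bringing \<open>Q n\<close> closest to \<open>Q'\<close>; a minimum
    exists among finitely many candidates.\<close>
  define s where "s n = (SOME s. is_arg_min (\<lambda>s. dist (diag_matrix s ** Q n) Q') (\<lambda>s. s \<in> ?S) s)" for n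
  have "is_arg_min (\<lambda>s. dist (diag_matrix s ** Q n) Q') (\<lambda>s. s \<in> ?S) (s n)" for n
    unfolding s_def
    by (rule someI_ex) (rule ex_is_arg_min_if_finite[OF finite_sign_vectors \<open>?S \<noteq> {}\<close>])
  then have s: "\<And>n. s n \<in> ?S"
    and min: "\<And>n s'. s' \<in> ?S \<Longrightarrow> dist (diag_matrix (s n) ** Q n) Q' \<le> dist (diag_matrix s' ** Q n) Q'"
    unfolding is_arg_min_linorder by blast+
  have "(\<lambda>n. diag_matrix (s n) ** Q n) \<longlonglongrightarrow> Q'"
  proof (rule ccontr)
    assume "\<not> ?thesis"
    then obtain e where e: "e > 0" "\<not> (\<forall>\<^sub>F n in sequentially. dist (diag_matrix (s n) ** Q n) Q' < e)"
      by (auto simp: tendsto_iff)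
    \<comment> \<open>If convergence fails, even the best signs miss by \<open>e\<close> infinitely
      often, and enumerating these indices gives a subsequence.\<close>
    define A where "A = {n. e \<le> dist (diag_matrix (s n) ** Q n) Q'}"
    have "infinite A"
      using e(2) by (simp add: A_def not_eventually not_less frequently_cofinite flip: cofinite_eq_sequentially)
    define r where "r = enumerate A"
    have r: "strict_mono r" "\<And>n. r n \<in> A"
      using \<open>infinite A\<close> by (simp_all add: r_def strict_mono_enumerate enumerate_in_set)
    obtain K where K: "\<And>n. norm (T n) \<le> K"
      using convergent_imp_Bseq[of T] lim by (auto simp: convergent_def Bseq_def)
    define B where "B = real CARD('d) * K"
    have tr: "trace (T n) \<le> B" for n
    proof -
      have "trace (T n) \<le> (\<Sum>i\<in>(UNIV::'d set). K)"
        unfolding trace_def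
      proof (rule sum_mono)
        fix i :: 'd
        have "T n $ i $ i \<le> norm (T n $ i $ i)" by simp
        also have "\<dots> \<le> norm (T n $ i)" by (rule Finite_Cartesian_Product.norm_nth_le)
        also have "\<dots> \<le> norm (T n)" by (rule Finite_Cartesian_Product.norm_nth_le)
        finally show "T n $ i $ i \<le> K" using K[of n] by linarith
      qed
      then show ?thesis by (simp add: B_def)
    qed
    note bounds = indef_factorization_bounds[OF R J c]
    have nl: "norm (l n) \<le> real CARD('d) * B" for n
    proof -
      have "norm (l n) \<le> (\<Sum>i\<in>(UNIV::'d set). B)"
        using norm_le_sum_norm_nth[of "l n"] bounds(2)[of n] tr[of n]
        by (intro order_trans[OF norm_le_sum_norm_nth] sum_mono) (auto intro: order_trans)
      then show ?thesis by simp
    qed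
    have nQ: "norm (Q n) \<le> real CARD('d) * sqrt (B / c)" for n
    proof -
      have "norm (Q n $ i) \<le> sqrt (B / c)" for i
        using bounds(3)[of n i] divide_right_mono[OF tr[of n], of c] c(1)
        by (intro real_le_rsqrt) simp
      then have "norm (Q n) \<le> (\<Sum>i\<in>(UNIV::'d set). sqrt (B / c))"
        by (intro order_trans[OF norm_le_sum_norm_nth[of "Q n"]] sum_mono)
      then show ?thesis by simp
    qed
    have "bounded (range (\<lambda>n. (l (r n), Q (r n))))"
    proof (rule bounded_subset)
      show "range (\<lambda>n. (l (r n), Q (r n))) \<subseteq> cball 0 (real CARD('d) * B) \<times> cball 0 (real CARD('d) * sqrt (B / c))"
        using nl nQ by auto
    qed (intro bounded_Times bounded_cball)
    from bounded_imp_convergent_subsequence[OF this] obtain z t where t: "strict_mono t"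
      and "((\<lambda>n. (l (r n), Q (r n))) \<circ> t) \<longlonglongrightarrow> z" by blast
    then have z: "(\<lambda>n. l (r (t n))) \<longlonglongrightarrow> fst z" "(\<lambda>n. Q (r (t n))) \<longlonglongrightarrow> snd z"
      by (auto dest: tendsto_fst tendsto_snd simp: comp_def)
    have "strict_mono (r \<circ> t)" using r(1) t by (rule strict_mono_o)
    from LIMSEQ_subseq_LIMSEQ[OF lim this] have "(\<lambda>n. T (r (t n))) \<longlonglongrightarrow> S" by (simp add: comp_def)
    from indef_factorization_limit[OF R this z c(1) bounds(1)]
    have "indef_factorization J S (fst z) (snd z)" .
    from indef_factorization_unique[OF R' this J(1) distinct]
    obtain s' where s': "s' \<in> ?S" "snd z = diag_matrix s' ** Q'" by auto
    \<comment> \<open>Sign matrices are involutions, so the signs relating the limit point to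
      \<open>Q'\<close> bring the subsequence within \<open>e\<close> of \<open>Q'\<close>, against
      the optimality of \<open>s\<close>.\<close>
    have "(\<lambda>n. diag_matrix s' ** Q (r (t n))) \<longlonglongrightarrow> diag_matrix s' ** snd z"
      by (intro tendsto_intros z)
    also have "diag_matrix s' ** snd z = Q'"
      using s' by (simp add: sign_diag_mult matrix_mul_assoc)
    finally have "\<forall>\<^sub>F n in sequentially. dist (diag_matrix s' ** Q (r (t n))) Q' < e"
      using e(1) by (simp add: tendsto_iff)
    then obtain n where "dist (diag_matrix s' ** Q (r (t n))) Q' < e"
      by (auto simp: eventually_sequentially)
    moreover have "e \<le> dist (diag_matrix (s (r (t n))) ** Q (r (t n))) Q'" using r(2) by (simp add: A_def)
    ultimately show False using min[OF s'(1), of "r (t n)"] by linarith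
  qed
  then show ?thesis using s by (intro exI[of _ s]) auto
qed

section \<open>Inertia and the deterministic limit\<close>

lemma dim_coordinate_subspace:
  "dim {c :: ('d :: finite) rvec. \<forall>j. j \<notin> P \<longrightarrow> c $ j = 0} = card P"
proof -
  let ?d = "(\<lambda>j. axis j 1 :: 'd rvec) ` P"
  have inj: "inj (\<lambda>j. axis j 1 :: 'd rvec)" by (simp add: inj_on_def axis_eq_axis)
  have "dim {x :: 'd rvec. \<forall>i\<in>Basis. i \<notin> ?d \<longrightarrow> x \<bullet> i = 0} = card ?d"
    by (rule dim_substandard) (auto simp: Basis_vec_def)
  moreover have "{x :: 'd rvec. \<forall>i\<in>Basis. i \<notin> ?d \<longrightarrow> x \<bullet> i = 0} = {c. \<forall>j. j \<notin> P \<longrightarrow> c $ j = 0}"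
    by (auto simp: Basis_vec_def inner_axis axis_eq_axis image_iff)
  moreover have "card ?d = card P" using inj by (metis card_image inj_on_subset subset_UNIV)
  ultimately show ?thesis by simp
qed

lemma diag_matrix_quadratic: "x \<bullet> (diag_matrix a *v x) = (\<Sum>j\<in>UNIV. a $ j * (x $ j)\<^sup>2)"
  by (simp add: diag_matrix_vector inner_vec_def power2_eq_square mult_ac)

text \<open>One half of Sylvester's law of inertia: on the span of the rows of \<open>Q\<close> on which the form
  is positive, projecting to the positive coordinates of \<open>e\<close> is injective.\<close>

lemma inertia_le:
  fixes e s :: "('d :: finite) rvec"
  assumes Q: "Q ** diag_matrix e ** transpose Q = diag_matrix s"
    and e: "\<And>j. e $ j \<in> {-1, 1}"
  shows "card {j. s $ j = 1} \<le> card {j. e $ j = 1}"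
proof -
  define E where "E = {c :: 'd rvec. \<forall>j. j \<notin> {j. s $ j = 1} \<longrightarrow> c $ j = 0}"
  define E' where "E' = {c :: 'd rvec. \<forall>j. j \<notin> {j. e $ j = 1} \<longrightarrow> c $ j = 0}"
  define P where "P = diag_matrix (\<chi> j. if e $ j = 1 then 1 else 0) ** transpose Q"
  have sub: "subspace E" by (simp add: E_def subspace_def)
  have inj: "inj_on ((*v) P) E"
    unfolding linear_injective_on_subspace_0[OF matrix_vector_mul_linear sub]
  proof (intro ballI impI)
    fix c assume c: "c \<in> E" "P *v c = 0"
    define v where "v = transpose Q *v c"
    have v: "v $ j = 0" if "e $ j = 1" for j
      using arg_cong[OF c(2), of "\<lambda>x. x $ j"] that
      by (simp add: P_def v_def diag_matrix_vector del: transpose_matrix_vector flip: matrix_vector_mul_assoc)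
    \<comment> \<open>For \<open>c\<close> in the kernel, \<open>Q^T c\<close> lives on the negative
      coordinates of \<open>e\<close>, so one and the same value is \<open>c \<bullet> c\<close> and
      is nonpositive.\<close>
    have "c \<bullet> c = c \<bullet> (diag_matrix s *v c)"
      unfolding diag_matrix_quadratic
      by (subst inner_vec_def, rule sum.cong) (use c(1) in \<open>auto simp: E_def power2_eq_square\<close>)
    also have "\<dots> = v \<bullet> (diag_matrix e *v v)"
      unfolding Q[symmetric] v_def
      by (simp add: inner_matrix_vector[of c Q] del: transpose_matrix_vector flip: matrix_vector_mul_assoc)
    also have "\<dots> \<le> 0"
      unfolding diag_matrix_quadratic using e v by (intro sum_nonpos) (force simp: mult_le_0_iff)
    finally show "c = 0" by (metis inner_eq_zero_iff inner_ge_zero order_antisym)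
  qed
  have "card {j. s $ j = 1} = dim E" unfolding E_def by (rule dim_coordinate_subspace[symmetric])
  also have "\<dots> = dim ((*v) P ` E)"
    using inj sub by (intro dim_image_eq[symmetric] matrix_vector_mul_linear) (simp add: span_eq_iff[THEN iffD2])
  also have "\<dots> \<le> dim E'"
    by (intro dim_subset) (auto simp: E'_def P_def diag_matrix_vector simp flip: matrix_vector_mul_assoc)
  also have "\<dots> = card {j. e $ j = 1}" unfolding E'_def by (rule dim_coordinate_subspace)
  finally show ?thesis .
qed

lemma card_rank_less:
  assumes "p \<le> CARD('d :: {finite, linorder})"
  shows "card {j :: 'd. card {k. k < j} < p} = p"
proof -
  have "(\<lambda>j :: 'd. card {k. k < j}) ` {j. card {k. k < j} < p} = {..<p}"
  proof (intro subset_antisym subsetI)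
    fix m assume "m \<in> {..<p}"
    then have "m \<in> range (\<lambda>j :: 'd. card {k. k < j})" "m < p"
      using rank_bij[where 'd='d] assms by (simp_all add: bij_betw_def)
    then show "m \<in> (\<lambda>j :: 'd. card {k. k < j}) ` {j. card {k. k < j} < p}" by blast
  qed blast
  moreover have "inj_on (\<lambda>j :: 'd. card {k. k < j}) {j. card {k. k < j} < p}"
    using rank_bij[where 'd='d] by (auto simp: bij_betw_def intro: inj_on_subset)
  ultimately show ?thesis by (metis card_image card_lessThan)
qed

lemma sig_matrix_eq:
  assumes "CARD('d :: {finite, linorder}) = p + q"
  shows "sig_matrix p q = diag_matrix (\<chi> i :: 'd. if card {k. k < i} < p then 1 else -1)"
proof -
  have "card {k. k < i} < p + q" for i :: 'd
    using rank_bij[where 'd='d] assms by (auto simp: bij_betw_def)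
  then show ?thesis by (auto simp: sig_matrix_def vec_eq_iff diag_matrix_nth)
qed

text \<open>The inertia bound for the form and for its negative fixes the number of positive entries
  of \<open>l\<close> at \<open>p\<close>. As \<open>l\<close> is decreasing these come first, so
  \<open>sgn l\<close> is the diagonal of the signature matrix itself.\<close>

lemma indef_factorization_indef_orthogonal:
  fixes S :: "('d :: {finite, linorder}) rmat"
  assumes R: "indef_factorization (sig_matrix p q) S l Q" and d: "CARD('d) = p + q"
  shows "Q \<in> indef_orthogonal p q"
proof -
  define e :: "'d rvec" where "e = (\<chi> i. if card {k. k < i} < p then 1 else -1)"
  have J: "sig_matrix p q = diag_matrix e" unfolding e_def by (rule sig_matrix_eq[OF d])
  have e: "e $ j \<in> {-1, 1}" for j by (simp add: e_def)
  let ?s = "sgn_vec l"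
  have s: "?s $ j \<in> {-1, 1}" for j
    using R by (auto simp: indef_factorization_def sgn_vec_def sgn_if)
  have Q: "Q ** diag_matrix e ** transpose Q = diag_matrix ?s"
    using R by (simp add: indef_factorization_def J)
  have "diag_matrix (- a) = - diag_matrix a" for a :: "'d rvec" by (simp add: vec_eq_iff diag_matrix_nth)
  moreover have "Q ** (- A) ** transpose Q = - (Q ** A ** transpose Q)" for A
    by (simp add: vec_eq_iff matrix_matrix_mult_def sum_negf)
  ultimately have Q': "Q ** diag_matrix (- e) ** transpose Q = diag_matrix (- ?s)" using Q by simp
  have p: "card {j. e $ j = 1} = p" using card_rank_less[where 'd='d, of p] d by (simp add: e_def)
  have compl: "card {j. (- a) $ j = 1} = CARD('d) - card {j. a $ j = 1}"
    if "\<And>j. a $ j \<in> {-1, 1}" for a :: "'d rvec"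
  proof -
    have "(- a) $ j = 1 \<longleftrightarrow> a $ j \<noteq> 1" for j using that[of j] by auto
    then have "{j. (- a) $ j = 1} = - {j. a $ j = 1}" by blast
    then show ?thesis by (simp add: Compl_eq_Diff_UNIV card_Diff_subset)
  qed
  have "card {j. ?s $ j = 1} \<le> p" using inertia_le[OF Q e] p by simp
  moreover have "card {j. (- ?s) $ j = 1} \<le> card {j. (- e) $ j = 1}"
    using e by (intro inertia_le[OF Q']) auto
  ultimately have card_s: "card {j. ?s $ j = 1} = p"
    unfolding compl[OF e] compl[OF s] p using d by linarith
  have antimono: "?s $ j = 1" if "?s $ k = 1" "j \<le> k" for j k
    using that R unfolding indef_factorization_def sgn_vec_def by (simp add: sgn_1_pos) (meson less_le_trans)
  have "?s $ j = 1 \<longleftrightarrow> card {k. k < j} < p" for j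
  proof
    assume "?s $ j = 1"
    then have "{k. k < j} \<subset> {j. ?s $ j = 1}" using antimono by auto
    then show "card {k. k < j} < p" using card_s by (metis finite psubset_card_mono)
  next
    assume lt: "card {k. k < j} < p"
    show "?s $ j = 1"
    proof (rule ccontr)
      assume "?s $ j \<noteq> 1"
      then have "k < j" if "?s $ k = 1" for k using antimono[OF that, of j] by (cases "j \<le> k") auto
      then have "{j. ?s $ j = 1} \<subseteq> {k. k < j}" by blast
      then have "p \<le> card {k. k < j}" using card_s by (metis card_mono finite)
      then show False using lt by simp
    qed
  qed
  then have "?s = e" using s by (auto simp: vec_eq_iff e_def)
  then show ?thesis using Q by (simp add: indef_orthogonal_def J)
qed

section \<open>From convergence of the scaled second moments to convergence of
  \<open>Q\<close>\<close>

lemma inner_matrix_vector_le: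
  "\<bar>y \<bullet> (A *v y)\<bar> \<le> real CARD('d) * norm A * (norm y)\<^sup>2" for A :: "('d :: finite) rmat"
proof -
  have "\<bar>y $ i * (A $ i \<bullet> y)\<bar> \<le> norm A * (norm y)\<^sup>2" for i
  proof -
    have "\<bar>A $ i \<bullet> y\<bar> \<le> norm (A $ i) * norm y" by (rule Cauchy_Schwarz_ineq2)
    also have "\<dots> \<le> norm A * norm y" by (intro mult_right_mono Finite_Cartesian_Product.norm_nth_le) simp
    finally have "\<bar>y $ i\<bar> * \<bar>A $ i \<bullet> y\<bar> \<le> norm y * (norm A * norm y)"
      using component_le_norm_cart[of y i] by (intro mult_mono) auto
    then show ?thesis by (simp add: abs_mult power2_eq_square mult_ac)
  qed
  then have "(\<Sum>i\<in>(UNIV :: 'd set). \<bar>y $ i * (A $ i \<bullet> y)\<bar>) \<le> (\<Sum>i\<in>(UNIV :: 'd set). norm A * (norm y)\<^sup>2)"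
    by (intro sum_mono)
  then have "(\<Sum>i\<in>(UNIV :: 'd set). \<bar>y $ i * (A $ i \<bullet> y)\<bar>) \<le> real CARD('d) * norm A * (norm y)\<^sup>2"
    by simp
  then show ?thesis
    unfolding matrix_mult_dot inner_vec_def[of y] by (auto intro: order_trans[OF sum_abs])
qed

text \<open>A perturbation of the matrix changes the form uniformly on the unit sphere, so half of
  the coercivity constant of the limit eventually survives.\<close>

lemma eventually_coercive:
  fixes S :: "('d :: finite) rmat"
  assumes lim: "T \<longlonglongrightarrow> S" and S: "pos_def S"
  obtains c where "c > 0" "\<forall>\<^sub>F n in sequentially. \<forall>y. c * (norm y)\<^sup>2 \<le> y \<bullet> (T n *v y)"
proof -
  obtain c where c: "c > 0" "\<And>y. c * (norm y)\<^sup>2 \<le> y \<bullet> (S *v y)" using pos_def_coercive[OF S] by blast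
  let ?d = "real CARD('d)"
  have d: "0 < ?d" by simp
  have "\<forall>\<^sub>F n in sequentially. dist (T n) S < c / (2 * ?d)"
    using lim c(1) d by (intro tendstoD) auto
  then have "\<forall>\<^sub>F n in sequentially. \<forall>y. c / 2 * (norm y)\<^sup>2 \<le> y \<bullet> (T n *v y)"
  proof eventually_elim
    case (elim n)
    show ?case
    proof
      fix y :: "'d rvec"
      have "y \<bullet> (T n *v y) = y \<bullet> (S *v y) + y \<bullet> ((T n - S) *v y)"
        by (simp add: matrix_vector_mult_diff_rdistrib inner_diff_right)
      moreover have "?d * norm (T n - S) * (norm y)\<^sup>2 \<le> c / 2 * (norm y)\<^sup>2"
        using elim d by (intro mult_right_mono) (simp_all add: dist_norm field_simps)
      ultimately show "c / 2 * (norm y)\<^sup>2 \<le> y \<bullet> (T n *v y)"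
        using inner_matrix_vector_le[of y "T n - S"] c(2)[of y] by (simp add: abs_le_iff)
    qed
  qed
  then show thesis using that[of "c / 2"] c(1) by simp
qed

lemma pos_def_invertible:
  assumes "pos_def S"
  shows "invertible S"
proof -
  have "S *v x = 0 \<Longrightarrow> x = 0" for x using assms by (metis inner_zero_right less_irrefl pos_def_def)
  then show ?thesis by (metis invertible_left_inverse matrix_left_invertible_ker)
qed

text \<open>Signs ignore positive factors and absolute values carry them along, so dividing by
  \<open>n\<close> leaves \<open>Q\<close> untouched.\<close>

lemma indef_factorization_scale:
  assumes R: "indef_factorization J S l Q" and a: "a > 0"
  shows "indef_factorization J (a *\<^sub>R S) (a *\<^sub>R l) Q"
proof -
  have "sgn_vec (a *\<^sub>R l) = sgn_vec l" using a by (simp add: sgn_vec_def vec_eq_iff sgn_mult)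
  moreover have "diag_matrix (abs_vec (a *\<^sub>R l)) = a *\<^sub>R diag_matrix (abs_vec l)"
    using a by (simp add: abs_vec_def diag_matrix_nth vec_eq_iff abs_mult)
  moreover have "transpose Q ** (a *\<^sub>R A) ** Q = a *\<^sub>R (transpose Q ** A ** Q)" for A
    by (metis scalar_matrix_assoc matrix_scalar_ac)
  ultimately show ?thesis using R a by (simp add: indef_factorization_def mult_left_mono)
qed

text \<open>A sign matrix commutes with the diagonal factor and squares to the identity, so
  \<open>Q\<close> absorbs the sign change in its rows.\<close>

lemma is_Q_matrix_scale_columns:
  assumes Q: "is_Q_matrix n x U L Q" and s: "\<forall>j. s $ j \<in> {-1, 1}"
  shows "is_Q_matrix n x (scale_columns s U) L (diag_matrix s ** Q)"
proof -
  have U: "scale_columns s U i = U i v* diag_matrix s" for i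
    using vector_transpose_matrix[of "U i" "diag_matrix s"]
    by (simp add: scale_columns_def diag_matrix_vector vec_eq_iff)
  have "diag_matrix s ** (sqrt_abs_diag L ** (diag_matrix s ** Q)) = (diag_matrix s ** diag_matrix s) ** (sqrt_abs_diag L ** Q)"
    unfolding sqrt_abs_diag_def matrix_mul_assoc diag_matrix_mult by (simp add: mult_ac)
  also have "\<dots> = sqrt_abs_diag L ** Q" by (simp add: sign_diag_mult[OF s])
  finally show ?thesis using Q by (simp add: is_Q_matrix_def U vector_matrix_mul_assoc)
qed

lemma transpose_sum_outer_prod:
  "transpose (\<Sum>i<(n::nat). outer_prod (x i) (x i)) = (\<Sum>i<n. outer_prod (x i) (x i))"
  by (simp add: vec_eq_iff transpose_nth outer_prod_def mult.commute)

text \<open>The argument for a single sample path: eventually the second moments are positive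
  definite, so factorizations exist, and every given eigendecomposition yields one to which
  convergence applies after division by \<open>n\<close>.\<close>

lemma Q_matrix_convergence:
  fixes x :: "nat \<Rightarrow> ('d :: {finite, linorder}) rvec"
  assumes lim: "(\<lambda>n. (1 / real n) *\<^sub>R (\<Sum>i<n. outer_prod (x i) (x i))) \<longlonglongrightarrow> S"
    and S: "pos_def S"
    and J: "J ** J = mat 1" "transpose J = J"
    and R': "indef_factorization J S l' Q'"
    and distinct: "distinct_eigenvalues (S ** J)"
  shows "\<forall>\<^sub>F n in sequentially. \<exists>U L. eigendecomposition n (\<lambda>i k. x i \<bullet> (J *v x k)) (U :: nat \<Rightarrow> 'd rvec) L" (is ?ex)
    and "\<forall>\<^sub>F n in sequentially. eigendecomposition n (\<lambda>i k. x i \<bullet> (J *v x k)) (U n) (L n) \<Longrightarrow>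
      \<exists>s Q. (\<forall>n j. s n $ j \<in> {-1, 1}) \<and>
        (\<forall>\<^sub>F n in sequentially. is_Q_matrix n x (scale_columns (s n) (U n)) (L n) (Q n)) \<and> Q \<longlonglongrightarrow> Q'"
    (is "?eig \<Longrightarrow> ?conv")
proof -
  define T where "T n = (\<Sum>i<n. outer_prod (x i) (x i))" for n
  define T' where "T' n = (1 / real n) *\<^sub>R T n" for n
  have lim': "T' \<longlonglongrightarrow> S" using lim by (simp add: T'_def[abs_def] T_def)
  obtain c where c: "c > 0" "\<forall>\<^sub>F n in sequentially. \<forall>y. c * (norm y)\<^sup>2 \<le> y \<bullet> (T' n *v y)"
    using eventually_coercive[OF lim' S] by blast
  have pd: "pos_def (T n)" if "n > 0" "\<forall>y. c * (norm y)\<^sup>2 \<le> y \<bullet> (T' n *v y)" for n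
    unfolding pos_def_def
  proof (intro conjI allI impI)
    show "transpose (T n) = T n" unfolding T_def by (rule transpose_sum_outer_prod)
    fix y :: "'d rvec" assume "y \<noteq> 0"
    then have "0 < c * (norm y)\<^sup>2" using c(1) by simp
    also have "\<dots> \<le> y \<bullet> (T' n *v y)" using that(2) by blast
    also have "\<dots> = (y \<bullet> (T n *v y)) / real n"
      by (simp add: T'_def flip: scaleR_matrix_vector_assoc)
    finally show "0 < y \<bullet> (T n *v y)" using that(1) by (simp add: zero_less_divide_iff)
  qed
  show ?ex
    using c(2) eventually_gt_at_top[of 0]
  proof eventually_elim
    case (elim n)
    with pd have "pos_def (T n)" by simp
    from indef_factorization_exists[OF this J] obtain L Q where "indef_factorization J (T n) L Q" by blast
    from factorization_imp_eigendecomposition[OF this J T_def] show ?case by blast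
  qed
  show ?conv if eig: ?eig
  proof -
    obtain N where N: "\<And>n. n \<ge> N \<Longrightarrow> n > 0 \<and> (\<forall>y. c * (norm y)\<^sup>2 \<le> y \<bullet> (T' n *v y)) \<and>
        eigendecomposition n (\<lambda>i k. x i \<bullet> (J *v x k)) (U n) (L n)"
      using eventually_conj[OF eventually_gt_at_top[of 0] eventually_conj[OF c(2) eig]]
      unfolding eventually_sequentially by blast
    have "\<exists>Q. is_Q_matrix n x (U n) (L n) Q \<and> indef_factorization J (T n) (L n) Q" if "n \<ge> N" for n
      by (rule eigendecomposition_imp_factorization[OF _ J T_def pos_def_invertible[OF pd]])
        (use N[OF that] in auto)
    then obtain Q where Q: "\<And>n. n \<ge> N \<Longrightarrow> is_Q_matrix n x (U n) (L n) (Q n)"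
      and R: "\<And>n. n \<ge> N \<Longrightarrow> indef_factorization J (T n) (L n) (Q n)" by metis
    have "\<exists>s. (\<forall>n j. s n $ j \<in> {-1, 1}) \<and> (\<lambda>n. diag_matrix (s n) ** Q (n + N)) \<longlonglongrightarrow> Q'"
    proof (rule indef_factorization_convergence[OF _ _ J c(1) _ R' distinct])
      show "indef_factorization J (T' (n + N)) ((1 / real (n + N)) *\<^sub>R L (n + N)) (Q (n + N))" for n
        unfolding T'_def using R[of "n + N"] N[of "n + N"] by (intro indef_factorization_scale) auto
      show "(\<lambda>n. T' (n + N)) \<longlonglongrightarrow> S" using lim' by (rule LIMSEQ_ignore_initial_segment)
      show "c * (norm y)\<^sup>2 \<le> y \<bullet> (T' (n + N) *v y)" for n y using N[of "n + N"] by simp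
    qed
    then obtain s where s: "\<And>n j. s n $ j \<in> {-1, 1}"
      and conv: "(\<lambda>n. diag_matrix (s n) ** Q (n + N)) \<longlonglongrightarrow> Q'" by blast
    \<comment> \<open>This undoes the shift by \<open>N\<close>. For \<open>n < N\<close> truncated
      subtraction yields \<open>s 0\<close>, still a sign vector.\<close>
    define Q'' where "Q'' n = diag_matrix (s (n - N)) ** Q n" for n
    have "(\<lambda>n. Q'' (n + N)) \<longlonglongrightarrow> Q'" using conv by (simp add: Q''_def)
    then have "Q'' \<longlonglongrightarrow> Q'" by (rule LIMSEQ_offset)
    moreover have "\<forall>\<^sub>F n in sequentially. is_Q_matrix n x (scale_columns (s (n - N)) (U n)) (L n) (Q'' n)"
      using eventually_ge_at_top[of N]
    proof eventually_elim
      case (elim n)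
      show ?case unfolding Q''_def using s by (intro is_Q_matrix_scale_columns Q elim) blast
    qed
    ultimately show ?thesis using s by (intro exI[of _ "\<lambda>n. s (n - N)"] exI[of _ Q'']) auto
  qed
qed

section \<open>The law of large numbers for the second moment\<close>

lemma slln_bounded:
  fixes Y :: "nat \<Rightarrow> 'a \<Rightarrow> real"
  assumes "prob_space M" and indep: "prob_space.indep_vars M (\<lambda>_. borel) Y UNIV"
    and bound: "\<And>i. AE \<omega> in M. \<bar>Y i \<omega>\<bar> \<le> C" and C: "C > 0"
    and mean: "\<And>i. (\<integral>\<omega>. Y i \<omega> \<partial>M) = m"
  shows "AE \<omega> in M. (\<lambda>n. (\<Sum>i<n. Y i \<omega>) / real n) \<longlonglongrightarrow> m"
proof -
  interpret prob_space M by fact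
  have Y [measurable]: "Y i \<in> borel_measurable M" for i
    using indep by (auto simp: indep_vars_def)
  have ev: "AE \<omega> in M. \<forall>\<^sub>F n in sequentially. \<bar>(\<Sum>i<n. Y i \<omega>) - real n * m\<bar> < real n * e"
    if e: "e > 0" for e
  proof -
    \<comment> \<open>Hoeffding's exponent for \<open>n\<close> variables with ranges of length
      \<open>2 * C\<close> and deviation \<open>n * e\<close> is \<open>- n * k\<close>, so the
      bounds form a geometric series.\<close>
    define k where "k = e\<^sup>2 / (2 * C\<^sup>2)"
    have k: "k > 0" using e C by (simp add: k_def)
    define A where "A n = {\<omega> \<in> space M. \<bar>(\<Sum>i<n. Y i \<omega>) - real n * m\<bar> \<ge> real n * e}" for n
    have A [measurable]: "A n \<in> sets M" for n unfolding A_def by measurable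
    have le: "measure M (A n) \<le> 2 * exp (- k) ^ n" for n
    proof (cases "n = 0")
      case True
      then show ?thesis using order_trans[OF prob_le_1[of "A n"], of 2] by simp
    next
      case False
      interpret Hoeffding_ineq M "{..<n}" Y "\<lambda>_. - C" "\<lambda>_. C" "\<Sum>i<n. expectation (Y i)"
      proof unfold_locales
        show "indep_vars (\<lambda>_. borel) Y {..<n}" using indep by (rule indep_vars_subset) simp
        show "AE x in M. Y i x \<in> {- C..C}" for i using bound[of i] by eventually_elim auto
      qed simp_all
      have "prob {x \<in> space M. real n * e \<le> \<bar>(\<Sum>i<n. Y i x) - (\<Sum>i<n. expectation (Y i))\<bar>}
          \<le> 2 * exp (- 2 * (real n * e)\<^sup>2 / (\<Sum>i<n. (C - - C)\<^sup>2))"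
        by (rule Hoeffding_ineq_abs_ge) (use e C False in auto)
      also have "- 2 * (real n * e)\<^sup>2 / (\<Sum>i<n. (C - - C)\<^sup>2) = real n * - k"
        using False C by (simp add: k_def field_simps power2_eq_square)
      finally show ?thesis by (simp add: A_def mean flip: exp_of_nat_mult)
    qed
    have "summable (\<lambda>n. 2 * exp (- k) ^ n)" using k by (intro summable_mult summable_geometric) simp
    then have "summable (\<lambda>n. measure M (A n))"
      by (rule summable_comparison_test') (use le in simp)
    then have "AE \<omega> in M. \<forall>\<^sub>F n in sequentially. \<omega> \<in> space M - A n"
      by (intro borel_cantelli_AE1) (auto simp: emeasure_eq_measure)
    then show ?thesis
      by eventually_elim (auto simp: A_def elim!: eventually_mono)
  qed
  \<comment> \<open>Countably many tolerances suffice, so a single null set serves for all of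
    them.\<close>
  have "AE \<omega> in M. \<forall>j::nat. \<forall>\<^sub>F n in sequentially. \<bar>(\<Sum>i<n. Y i \<omega>) - real n * m\<bar> < real n * (1 / real (Suc j))"
    unfolding AE_all_countable by (intro allI ev) simp
  then show ?thesis
  proof eventually_elim
    case (elim \<omega>)
    show ?case
    proof (rule tendstoI)
      fix e :: real assume "e > 0"
      then obtain j where j: "1 / real (Suc j) < e" using nat_approx_posE by (metis)
      show "\<forall>\<^sub>F n in sequentially. dist ((\<Sum>i<n. Y i \<omega>) / real n) m < e"
        using elim[rule_format, of j] eventually_gt_at_top[of 0]
      proof eventually_elim
        case (elim n)
        have "(\<Sum>i<n. Y i \<omega>) / real n - m = ((\<Sum>i<n. Y i \<omega>) - real n * m) / real n"
          using elim(2) by (simp add: diff_divide_distrib)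
        then have "\<bar>(\<Sum>i<n. Y i \<omega>) / real n - m\<bar> < 1 / real (Suc j)"
          using elim by (simp only: abs_divide) (simp add: pos_divide_less_eq mult.commute)
        then show ?case using j by (simp add: dist_real_def)
      qed
    qed
  qed
qed

section \<open>The second moment of \<open>F\<close>: positivity, bounded support and convergence of
  its empirical version\<close>

text \<open>\<open>y \<bullet> (A *v z)\<close> is a bounded linear functional of the matrix
  \<open>A\<close> and so commutes with the Bochner integral.\<close>

lemma second_moment_form:
  assumes int: "integrable F (\<lambda>x. outer_prod x x)"
  shows "integrable F (\<lambda>x. (x \<bullet> z) * (y \<bullet> x))"
    and "y \<bullet> (second_moment F *v z) = (\<integral>x. (x \<bullet> z) * (y \<bullet> x) \<partial>F)"
proof -
  have "linear (\<lambda>A :: 'a rmat. y \<bullet> (A *v z))"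
    by (rule linearI) (simp_all add: matrix_vector_mult_add_rdistrib inner_add_right flip: scaleR_matrix_vector_assoc)
  then have bl: "bounded_linear (\<lambda>A :: 'a rmat. y \<bullet> (A *v z))" by (simp add: linear_conv_bounded_linear)
  show "integrable F (\<lambda>x. (x \<bullet> z) * (y \<bullet> x))"
    using integrable_bounded_linear[OF bl int] by (simp add: outer_prod_vector)
  show "y \<bullet> (second_moment F *v z) = (\<integral>x. (x \<bullet> z) * (y \<bullet> x) \<partial>F)"
    using integral_bounded_linear[OF bl int] by (simp add: second_moment_def outer_prod_vector)
qed

text \<open>Boundedness on \<open>X\<close> is preserved under linear combinations of functionals,
  so generators decide.\<close>

lemma bounded_on_span:
  assumes z: "z \<in> span A" and A: "\<And>w. w \<in> A \<Longrightarrow> \<exists>B. \<forall>x\<in>X. \<bar>w \<bullet> x\<bar> \<le> B"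
  shows "\<exists>B. \<forall>x\<in>X. \<bar>z \<bullet> x\<bar> \<le> (B :: real)"
  using z
proof (induction rule: span_induct_alt)
  case base
  show ?case by (intro exI[of _ 0]) simp
next
  case (step c w z)
  obtain B where B: "\<forall>x\<in>X. \<bar>w \<bullet> x\<bar> \<le> B" using A[OF step(1)] by blast
  obtain B' where B': "\<forall>x\<in>X. \<bar>z \<bullet> x\<bar> \<le> B'" using step(2) by blast
  have "\<bar>(c *\<^sub>R w + z) \<bullet> x\<bar> \<le> \<bar>c\<bar> * B + B'" if "x \<in> X" for x
  proof -
    have "\<bar>(c *\<^sub>R w + z) \<bullet> x\<bar> \<le> \<bar>c\<bar> * \<bar>w \<bullet> x\<bar> + \<bar>z \<bullet> x\<bar>"
      by (simp add: inner_add_left flip: abs_mult)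
    also have "\<dots> \<le> \<bar>c\<bar> * B + B'" using B B' that by (intro add_mono mult_left_mono) auto
    finally show ?thesis .
  qed
  then show ?case by blast
qed

text \<open>The form at \<open>y\<close> is the mean of \<open>(y \<bullet> x)^2\<close>. If it
  vanished, \<open>F\<close> would live on the hyperplane orthogonal to \<open>y\<close>, and
  \<open>y\<close> would lie in the kernel of an invertible matrix.\<close>

lemma second_moment_pos_def:
  assumes int: "integrable F (\<lambda>x. outer_prod x x)" and inv: "invertible (second_moment F)"
  shows "pos_def (second_moment F)"
    and "y \<noteq> 0 \<Longrightarrow> \<not> (AE x in F. y \<bullet> x = 0)"
proof -
  note form = second_moment_form[OF int]
  show neg: "\<not> (AE x in F. y \<bullet> x = 0)" if "y \<noteq> 0" for y
  proof
    assume ae: "AE x in F. y \<bullet> x = 0"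
    have "z \<bullet> (second_moment F *v y) = 0" for z
    proof -
      have "z \<bullet> (second_moment F *v y) = (\<integral>x. 0 \<partial>F)"
        unfolding form
      proof (rule integral_cong_AE)
        show "(\<lambda>x. (x \<bullet> y) * (z \<bullet> x)) \<in> borel_measurable F" using form(1) by (rule borel_measurable_integrable)
        show "AE x in F. (x \<bullet> y) * (z \<bullet> x) = 0" using ae by eventually_elim (simp add: inner_commute)
      qed simp
      then show ?thesis by simp
    qed
    then have "second_moment F *v y = 0" by (metis inner_eq_zero_iff)
    then show False using inv that by (metis invertible_left_inverse matrix_left_invertible_ker)
  qed
  show "pos_def (second_moment F)"
    unfolding pos_def_def
  proof (intro conjI allI impI)
    have "axis i 1 \<bullet> (second_moment F *v axis j 1) = axis j 1 \<bullet> (second_moment F *v axis i 1)" for i j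
      unfolding form by (simp add: inner_commute mult.commute)
    then show "transpose (second_moment F) = second_moment F"
      by (simp add: vec_eq_iff transpose_nth matrix_vector_mult_basis inner_axis' column_def)
    fix y :: "'a rvec" assume y: "y \<noteq> 0"
    have "0 \<le> (\<integral>x. (x \<bullet> y) * (y \<bullet> x) \<partial>F)"
      by (intro Bochner_Integration.integral_nonneg) (simp add: inner_commute)
    moreover have "(\<integral>x. (x \<bullet> y) * (y \<bullet> x) \<partial>F) \<noteq> 0"
    proof
      assume "(\<integral>x. (x \<bullet> y) * (y \<bullet> x) \<partial>F) = 0"
      then have "AE x in F. (x \<bullet> y) * (y \<bullet> x) = 0"
        by (subst (asm) integral_nonneg_eq_0_iff_AE[OF form(1)]) (simp_all add: inner_commute)
      then have "AE x in F. y \<bullet> x = 0" by eventually_elim (simp add: inner_commute)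
      then show False using neg[OF y] by simp
    qed
    ultimately show "0 < y \<bullet> (second_moment F *v y)" unfolding form by simp
  qed
qed

text \<open>Since \<open>F\<close> charges no hyperplane, \<open>\<Omega>\<close> spans the space; boundedness of the form against
  a spanning set bounds every coordinate.\<close>

lemma gip_distribution_bounded:
  fixes F :: "('d :: {finite, linorder}) rvec measure"
  assumes F: "gip_distribution p q F"
    and J: "sig_matrix p q ** sig_matrix p q = (mat 1 :: 'd rmat)" "transpose (sig_matrix p q :: 'd rmat) = sig_matrix p q"
    and hyper: "\<And>y. y \<noteq> 0 \<Longrightarrow> \<not> (AE x in F. y \<bullet> x = 0)"
  shows "\<exists>C. AE x in F. \<forall>i. \<bar>x $ i\<bar> \<le> C"
proof -
  let ?J = "sig_matrix p q :: 'd rmat"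
  from F obtain \<Omega> where \<Omega>: "AE x in F. x \<in> \<Omega>" "\<And>x y. x \<in> \<Omega> \<Longrightarrow> y \<in> \<Omega> \<Longrightarrow> x \<bullet> (?J *v y) \<in> {0..1}"
    unfolding gip_distribution_def by blast
  have "span \<Omega> = UNIV"
  proof (rule ccontr)
    assume "span \<Omega> \<noteq> UNIV"
    then obtain y where y: "y \<noteq> 0" "span \<Omega> \<subseteq> {x. y \<bullet> x = 0}"
      using span_not_univ_subset_hyperplane by blast
    have "AE x in F. y \<bullet> x = 0"
      using \<Omega>(1) by eventually_elim (use y(2) in \<open>auto dest: span_base\<close>)
    then show False using hyper[OF y(1)] by simp
  qed
  then have "\<exists>B. \<forall>x\<in>(*v) ?J ` \<Omega>. \<bar>z \<bullet> x\<bar> \<le> B" for z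
    using \<Omega>(2) by (intro bounded_on_span[of z \<Omega>]) (auto intro!: exI[of _ 1] simp: abs_le_iff, force)
  then have "\<exists>B. \<forall>x\<in>\<Omega>. \<bar>x $ i\<bar> \<le> B" for i
  proof -
    \<comment> \<open>Since \<open>J\<close> is a symmetric involution, testing
      \<open>J *v x\<close> against \<open>J *v axis i 1\<close> reads off coordinate
      \<open>i\<close> of \<open>x\<close>.\<close>
    obtain B where B: "\<And>x. x \<in> \<Omega> \<Longrightarrow> \<bar>(?J *v axis i 1) \<bullet> (?J *v x)\<bar> \<le> B"
      using \<open>\<And>z. \<exists>B. \<forall>x\<in>(*v) ?J ` \<Omega>. \<bar>z \<bullet> x\<bar> \<le> B\<close>[of "?J *v axis i 1"] by auto
    have "(?J *v axis i 1) \<bullet> (?J *v x) = x $ i" for x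
    proof -
      have "?J *v (?J *v x) = x" by (simp add: J matrix_vector_mul_assoc)
      then show ?thesis
        using inner_matrix_vector[of "axis i 1" ?J "?J *v x"]
        by (simp add: J inner_axis' del: transpose_matrix_vector)
    qed
    then show ?thesis using B by auto
  qed
  then obtain B where B: "\<And>i x. x \<in> \<Omega> \<Longrightarrow> \<bar>x $ i\<bar> \<le> B i" by metis
  have "AE x in F. \<forall>i. \<bar>x $ i\<bar> \<le> Max (range B)"
    using \<Omega>(1)
  proof eventually_elim
    case (elim x)
    then show ?case by (intro allI order_trans[OF B Max_ge]) auto
  qed
  then show ?thesis by blast
qed

text \<open>Matrix convergence is entrywise, and the entries of the outer products are bounded
  independent variables with a common mean.\<close>

lemma second_moment_slln:
  fixes X :: "nat \<Rightarrow> 'a \<Rightarrow> ('d :: {finite, linorder}) rvec"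
  assumes M: "prob_space M"
    and indep: "prob_space.indep_vars M (\<lambda>_. borel) X UNIV"
    and distr: "\<And>i. distr M borel (X i) = F"
    and int: "integrable F (\<lambda>x. outer_prod x x)"
    and bound: "AE x in F. \<forall>i. \<bar>x $ i\<bar> \<le> C"
  shows "AE \<omega> in M. (\<lambda>n. (1 / real n) *\<^sub>R (\<Sum>i<n. outer_prod (X i \<omega>) (X i \<omega>))) \<longlonglongrightarrow> second_moment F"
proof -
  interpret prob_space M by fact
  have X [measurable]: "X i \<in> borel_measurable M" for i
    using indep by (auto simp: indep_vars_def)
  have slln: "AE \<omega> in M. (\<lambda>n. (\<Sum>i<n. X i \<omega> $ a * X i \<omega> $ b) / real n) \<longlonglongrightarrow> second_moment F $ a $ b" for a b
  \<comment> \<open>The added 1 makes the bound strictly positive whatever \<open>C\<close>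
    is.\<close>
  proof (rule slln_bounded[OF M, where C = "C * C + 1"])
    show "indep_vars (\<lambda>_. borel) (\<lambda>i \<omega>. X i \<omega> $ a * X i \<omega> $ b) UNIV"
      using indep by (rule indep_vars_compose2) measurable
    show "C * C + 1 > 0" by (meson add_nonneg_pos zero_le_square zero_less_one)
    fix i
    have "AE x in distr M borel (X i). \<forall>i. \<bar>x $ i\<bar> \<le> C" unfolding distr by (rule bound)
    from AE_distrD[OF X this] show "AE \<omega> in M. \<bar>X i \<omega> $ a * X i \<omega> $ b\<bar> \<le> C * C + 1"
    proof eventually_elim
      case (elim \<omega>)
      then have "\<bar>X i \<omega> $ a\<bar> * \<bar>X i \<omega> $ b\<bar> \<le> C * C"
        by (intro mult_mono) (auto intro: order_trans[OF abs_ge_zero])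
      then show ?case by (simp add: abs_mult)
    qed
    have "(\<integral>\<omega>. X i \<omega> $ a * X i \<omega> $ b \<partial>M) = (\<integral>x. x $ a * x $ b \<partial>distr M borel (X i))"
      by (rule integral_distr[symmetric]) measurable
    also have "\<dots> = axis a 1 \<bullet> (second_moment F *v axis b 1)"
      unfolding second_moment_form[OF int] distr by (simp add: inner_axis inner_axis' mult.commute)
    also have "\<dots> = second_moment F $ a $ b"
      by (simp add: matrix_vector_mult_basis inner_axis' column_def)
    finally show "(\<integral>\<omega>. X i \<omega> $ a * X i \<omega> $ b \<partial>M) = second_moment F $ a $ b" .
  qed
  have "AE \<omega> in M. \<forall>a b. (\<lambda>n. (\<Sum>i<n. X i \<omega> $ a * X i \<omega> $ b) / real n) \<longlonglongrightarrow> second_moment F $ a $ b"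
    unfolding AE_all_countable by (intro allI slln)
  then show ?thesis
  proof eventually_elim
    case (elim \<omega>)
    then show ?case
      by (intro vec_tendstoI) (simp add: outer_prod_def)
  qed
qed

lemma sig_matrix_involution:
  assumes "CARD('d :: {finite, linorder}) = p + q"
  shows "sig_matrix p q ** sig_matrix p q = (mat 1 :: 'd rmat)"
    and "transpose (sig_matrix p q) = (sig_matrix p q :: 'd rmat)"
  unfolding sig_matrix_eq[OF assms] by (simp_all add: sign_diag_mult)

text \<open>Eigenvectors carry arbitrary signs, so the limit is claimed for every choice of
  eigendecompositions after suitable sign changes of columns, with one null set for all choices.
  Existence is asserted only eventually, since \<open>P\<close> has fewer than \<open>d\<close>
  nonzero eigenvalues when \<open>n\<close> is less than \<open>d\<close>.\<close>

theorem theorem2: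
  fixes M :: "'a measure"
    and X :: "nat \<Rightarrow> 'a \<Rightarrow> ('d :: {finite, linorder}) rvec"
    and F :: "'d rvec measure"
    and p q :: nat
  assumes "prob_space M"
    and "gip_distribution p q F"
    and "prob_space.indep_vars M (\<lambda>_. borel) X UNIV"
    and "\<And>i. distr M borel (X i) = F"
    and "distinct_eigenvalues (second_moment F ** sig_matrix p q)"
    and "rank (second_moment F ** sig_matrix p q) = CARD('d)"
  shows "\<exists>Qt \<in> indef_orthogonal p q. AE \<omega> in M.
    (\<forall>\<^sub>F n in sequentially. \<exists>(U :: nat \<Rightarrow> 'd rvec) L.
        eigendecomposition n (P_matrix p q (\<lambda>i. X i \<omega>)) U L) \<and>
    (\<forall>U L. (\<forall>\<^sub>F n in sequentially.
              eigendecomposition n (P_matrix p q (\<lambda>i. X i \<omega>)) (U n) (L n)) \<longrightarrow>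
       (\<exists>s Q. (\<forall>n j. s n $ j \<in> {- 1, 1}) \<and>
          (\<forall>\<^sub>F n in sequentially.
              is_Q_matrix n (\<lambda>i. X i \<omega>) (scale_columns (s n) (U n)) (L n) (Q n)) \<and>
          Q \<longlonglongrightarrow> Qt))"
proof -
  let ?J = "sig_matrix p q :: 'd rmat" and ?S = "second_moment F"
  have d: "CARD('d) = p + q" using assms(2) by (simp add: gip_distribution_def)
  note J = sig_matrix_involution[OF d]
  have "rank ?S = CARD('d)"
    using rank_mul_le_left[of ?S ?J] rank_bound[of ?S] assms(6) by simp
  then have inv: "invertible ?S"
    by (metis full_rank_injective invertible_left_inverse matrix_left_invertible_injective)
  have int: "integrable F (\<lambda>x. outer_prod x x)"
  proof (rule ccontr)
    \<comment> \<open>The default value of a divergent integral is the zero matrix, which full rank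
      excludes.\<close>
    assume "\<not> ?thesis"
    then have "?S = 0" unfolding second_moment_def by (rule not_integrable_integral_eq)
    then show False using \<open>rank ?S = CARD('d)\<close> by simp
  qed
  note pd = second_moment_pos_def[OF int inv]
  \<comment> \<open>\<open>Qt\<close> is obtained from the second moment of \<open>F\<close> alone,
    before any sample path is fixed; this is what makes the limit deterministic.\<close>
  obtain l Qt where Qt: "indef_factorization ?J ?S l Qt"
    using indef_factorization_exists[OF pd(1) J] by blast
  obtain C where C: "AE x in F. \<forall>i. \<bar>x $ i\<bar> \<le> C"
    using gip_distribution_bounded[OF assms(2) J pd(2)] by blast
  have P: "P_matrix p q x = (\<lambda>i k. x i \<bullet> (?J *v x k))" for x
    by (intro ext) (simp add: P_matrix_def)
  show ?thesis
  proof (rule bexI[OF _ indef_factorization_indef_orthogonal[OF Qt d]])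
    show "AE \<omega> in M.
      (\<forall>\<^sub>F n in sequentially. \<exists>(U :: nat \<Rightarrow> 'd rvec) L.
          eigendecomposition n (P_matrix p q (\<lambda>i. X i \<omega>)) U L) \<and>
      (\<forall>U L. (\<forall>\<^sub>F n in sequentially.
                eigendecomposition n (P_matrix p q (\<lambda>i. X i \<omega>)) (U n) (L n)) \<longrightarrow>
         (\<exists>s Q. (\<forall>n j. s n $ j \<in> {- 1, 1}) \<and>
            (\<forall>\<^sub>F n in sequentially.
                is_Q_matrix n (\<lambda>i. X i \<omega>) (scale_columns (s n) (U n)) (L n) (Q n)) \<and>
            Q \<longlonglongrightarrow> Qt))"
      using second_moment_slln[OF assms(1,3,4) int C]
    proof eventually_elim
      case (elim \<omega>)
      note conv = Q_matrix_convergence[OF elim pd(1) J Qt assms(5)]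
      show ?case
        unfolding P
      proof (rule conjI, rule conv(1), intro allI impI)
        fix U :: "nat \<Rightarrow> nat \<Rightarrow> 'd rvec" and L
        assume "\<forall>\<^sub>F n in sequentially. eigendecomposition n (\<lambda>i k. X i \<omega> \<bullet> (?J *v X k \<omega>)) (U n) (L n)"
        then show "\<exists>s Q. (\<forall>n j. s n $ j \<in> {- 1, 1}) \<and>
            (\<forall>\<^sub>F n in sequentially.
                is_Q_matrix n (\<lambda>i. X i \<omega>) (scale_columns (s n) (U n)) (L n) (Q n)) \<and>
            Q \<longlonglongrightarrow> Qt" by (rule conv(2))
      qed
    qed
  qed
qed

end
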